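(* Fix an integer $m\ge0$. Let $(M,g)$ be a non-trapping Riemannian surface with strictly convex boundary, and let $w:SM\to\mathbb{C}$ be a weight such that for any integer $k$ with $m-k$ even and $|k|\le m$, the scalar transform $L^2(M)\ni h\mapsto I_w[he^{ik\theta}]$ is injective. Then for any $f\in C^\infty(S^m(T^*M))$, the collection of transverse ray transforms $$I_w[\ell_{m,k}f],\qquad 0\le k\le m,$$ determines $f$ uniquely and explicitly; here uniqueness means that if $f,f'\in C^\infty(S^m(T^*M))$ satisfy $I_w[\ell_{m,k}f]=I_w[\ell_{m,k}f']$ for all $0\le k\le m$, then $f=f'$.
   Context: $M$ is compact with smooth boundary $\partial M$; non-trapping means that every geodesic reaches $\partial M$ in finite time. Under these assumptions $M$ is simply connected, hence oriented, and admits global isothermal coordinates: $g=e^{2\lambda(x)}(dx_1^2+dx_2^2)$, with $\theta$ the angle such that a unit tangent vector is $v=e^{-\lambda}(\cos\theta\,\partial_{x_1}+\sin\theta\,\partial_{x_2})$; $he^{ik\theta}$ denotes the function $(x,\theta)\mapsto h(x)e^{ik\theta}$ on the unit tangent bundle $SM$. Let $v\mapsto v^\perp$ be the direct rotation by $\pi/2$. $\partial_+SM=\{(x,v)\in SM:x\in\partial M,\ \langle v,\nu(x)\rangle\le0\}$ with $\nu$ the outer unit normal, $\varphi_t$ is the geodesic flow, and $\tau(x,v)$ is the first time the geodesic issued from $(x,v)$ hits $\partial M$. A weight is a non-vanishing function $w:SM\to\mathbb{C}$ such that the weighted ray transform $$I_wF(x,v)=\int_0^{\tau(x,v)}w(\varphi_t(x,v))F(\varphi_t(x,v))\,dt,\qquad(x,v)\in\partial_+SM,$$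 is a well-defined map $I_w:L^2(SM)\to L^2(\partial_+SM)$. $S^m(T^*M)$ is the bundle of symmetric $m$-tensors (complex-valued sections are considered), and for $0\le k\le m$, $$\ell_{m,k}f(x,v)=f_x\big(v^{m-k}\otimes(v^\perp)^k\big),\qquad(x,v)\in SM,$$ i.e. $f_x$ evaluated on $m-k$ copies of $v$ and $k$ copies of $v^\perp$. The word "explicitly" is an informal indication that $f$ can be recovered constructively from the data (given inversions of the scalar transforms); it carries no further precise content in the statement. *)

theory Defs
  imports "HOL-Analysis.Analysis" "HOL-Library.Multiset"
begin

section \<open>Smooth functions\<close>

text \<open>\<open>Ck_on k f W\<close> is meant for open \<open>W\<close>; \<open>smooth_on\<close> allows arbitrary sets
  (smoothness up to the boundary is local extendability).\<close>

primrec Ck_on :: "nat \<Rightarrow> ('a::real_normed_vector \<Rightarrow> 'b::real_normed_vector) \<Rightarrow> 'a set \<Rightarrow> bool" where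
  "Ck_on 0 f W \<longleftrightarrow> continuous_on W f"
| "Ck_on (Suc k) f W \<longleftrightarrow>
     f differentiable_on W \<and> (\<forall>v. Ck_on k (\<lambda>x. frechet_derivative f (at x) v) W)"

definition smooth_on :: "'a::real_normed_vector set \<Rightarrow> ('a \<Rightarrow> 'b::real_normed_vector) \<Rightarrow> bool" where
  "smooth_on A f \<longleftrightarrow>
     (\<forall>x\<in>A. \<exists>W F. open W \<and> x \<in> W \<and> (\<forall>k. Ck_on k F W) \<and> (\<forall>y\<in>A \<inter> W. F y = f y))"


section \<open>Compact surfaces with boundary\<close>

definition half_plane :: "complex set" where
  "half_plane = {z. 0 \<le> Im z}"

text \<open>A chart is a domain with a coordinate map into the closed upper half plane. A tangent
  vector at \<open>p\<close> is the family of its coordinate expressions in the charts around \<open>p\<close>,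
  related by the Jacobians of the transition maps, and zero at all other charts.\<close>

type_synonym 'a chart = "'a set \<times> ('a \<Rightarrow> complex)"
type_synonym 'a tangent = "'a chart \<Rightarrow> complex"

record 'a surface =
  points :: "'a set"
  charts :: "'a chart set"
  metric :: "'a \<Rightarrow> 'a tangent \<Rightarrow> 'a tangent \<Rightarrow> real"

definition chart_inv :: "'a chart \<Rightarrow> complex \<Rightarrow> 'a" where
  "chart_inv c = inv_into (fst c) (snd c)"

definition smooth_surface :: "('a::t2_space) surface \<Rightarrow> bool" where
  "smooth_surface S \<longleftrightarrow>
     compact (points S) \<and> connected (points S) \<and> points S \<noteq> {} \<and>
     points S = (\<Union>c\<in>charts S. fst c) \<and>
     (\<forall>c\<in>charts S. openin (top_of_set (points S)) (fst c) \<and>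
        openin (top_of_set half_plane) (snd c ` fst c) \<and>
        homeomorphism (fst c) (snd c ` fst c) (snd c) (chart_inv c)) \<and>
     (\<forall>c\<in>charts S. \<forall>d\<in>charts S.
        smooth_on (snd c ` (fst c \<inter> fst d)) (snd d \<circ> chart_inv c))"

definition charts_at :: "'a surface \<Rightarrow> 'a \<Rightarrow> 'a chart set" where
  "charts_at S p = {c \<in> charts S. p \<in> fst c}"

text \<open>Derivative at \<open>p\<close>, in the chart \<open>c\<close>, of a map defined on the surface near \<open>p\<close>.
  Derivatives within the half plane are unique, also at its boundary points.\<close>

definition chart_deriv :: "'a chart \<Rightarrow> 'a \<Rightarrow> ('a \<Rightarrow> complex) \<Rightarrow> complex \<Rightarrow> complex" where
  "chart_deriv c p F = frechet_derivative (F \<circ> chart_inv c) (at (snd c p) within half_plane)"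

definition tangent_space :: "'a surface \<Rightarrow> 'a \<Rightarrow> 'a tangent set" where
  "tangent_space S p =
     {v. (\<forall>c. c \<notin> charts_at S p \<longrightarrow> v c = 0) \<and>
         (\<forall>c\<in>charts_at S p. \<forall>d\<in>charts_at S p. v d = chart_deriv c p (snd d) (v c))}"

text \<open>The tangent vector at \<open>p\<close> with components \<open>a\<close> in the chart \<open>c\<close>.\<close>

definition coord_vec :: "'a surface \<Rightarrow> 'a chart \<Rightarrow> 'a \<Rightarrow> complex \<Rightarrow> 'a tangent" where
  "coord_vec S c p a = (\<lambda>d. if d \<in> charts_at S p then chart_deriv c p (snd d) a else 0)"

definition boundary :: "'a surface \<Rightarrow> 'a set" where
  "boundary S = {p \<in> points S. \<exists>c\<in>charts_at S p. Im (snd c p) = 0}"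

definition boundary_tangent_space :: "'a surface \<Rightarrow> 'a \<Rightarrow> 'a tangent set" where
  "boundary_tangent_space S p = {v \<in> tangent_space S p. \<forall>c\<in>charts_at S p. Im (v c) = 0}"


section \<open>Riemannian metrics\<close>

definition local_metric :: "'a surface \<Rightarrow> 'a chart \<Rightarrow> complex \<Rightarrow> complex \<Rightarrow> complex \<Rightarrow> real" where
  "local_metric S c z a b =
     metric S (chart_inv c z) (coord_vec S c (chart_inv c z) a) (coord_vec S c (chart_inv c z) b)"

definition riemannian_surface :: "('a::t2_space) surface \<Rightarrow> bool" where
  "riemannian_surface S \<longleftrightarrow>
     smooth_surface S \<and>
     (\<forall>p\<in>points S. \<forall>u\<in>tangent_space S p. \<forall>v\<in>tangent_space S p.
        metric S p u v = metric S p v u \<and>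
        (\<forall>w\<in>tangent_space S p. \<forall>r::real.
           metric S p (\<lambda>c. r *\<^sub>R u c + v c) w = r * metric S p u w + metric S p v w) \<and>
        (u \<noteq> (\<lambda>_. 0) \<longrightarrow> 0 < metric S p u u)) \<and>
     (\<forall>c\<in>charts S. \<forall>a b. smooth_on (snd c ` fst c) (\<lambda>z. local_metric S c z a b))"

text \<open>Unit tangent bundle \<open>SM\<close>.\<close>

definition unit_bundle :: "'a surface \<Rightarrow> ('a \<times> 'a tangent) set" where
  "unit_bundle S = {(x, v). x \<in> points S \<and> v \<in> tangent_space S x \<and> metric S x v v = 1}"

definition outer_normal :: "'a surface \<Rightarrow> 'a \<Rightarrow> 'a tangent" where
  "outer_normal S p = (THE n. n \<in> tangent_space S p \<and> metric S p n n = 1 \<and>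
     (\<forall>u\<in>boundary_tangent_space S p. metric S p n u = 0) \<and>
     (\<forall>c\<in>charts_at S p. Im (n c) < 0))"

text \<open>\<open>\<partial>\<^sub>+SM\<close>\<close>

definition influx :: "'a surface \<Rightarrow> ('a \<times> 'a tangent) set" where
  "influx S = {(x, v) \<in> unit_bundle S. x \<in> boundary S \<and> metric S x v (outer_normal S x) \<le> 0}"

text \<open>Christoffel symbols of the first kind: \<open>christoffel S c z a b w\<close> is
  \<open>\<langle>\<nabla>\<^sub>a b, w\<rangle>\<close> at \<open>z\<close>, where \<open>a\<close>, \<open>b\<close>, \<open>w\<close> are extended to vector fields that are constant
  in the chart \<open>c\<close>.\<close>

definition christoffel ::
  "'a surface \<Rightarrow> 'a chart \<Rightarrow> complex \<Rightarrow> complex \<Rightarrow> complex \<Rightarrow> complex \<Rightarrow> real" where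
  "christoffel S c z a b w =
     (frechet_derivative (\<lambda>y. local_metric S c y b w) (at z within half_plane) a
      + frechet_derivative (\<lambda>y. local_metric S c y a w) (at z within half_plane) b
      - frechet_derivative (\<lambda>y. local_metric S c y a b) (at z within half_plane) w) / 2"

text \<open>Positive definite second fundamental form
  \<open>\<langle>\<nabla>\<^sub>u \<nu>, u\<rangle> = - \<langle>\<nu>, \<nabla>\<^sub>u u\<rangle>\<close>. The boundary is flat in charts, so the extension of \<open>u\<close> that
  is constant in a chart is tangent to the boundary.\<close>

definition strictly_convex_boundary :: "'a surface \<Rightarrow> bool" where
  "strictly_convex_boundary S \<longleftrightarrow>
     (\<forall>p\<in>boundary S. \<forall>u\<in>boundary_tangent_space S p. u \<noteq> (\<lambda>_. 0) \<longrightarrow>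
        (\<forall>c\<in>charts_at S p. 0 < - christoffel S c (snd c p) (u c) (u c) (outer_normal S p c)))"


section \<open>Geodesics\<close>

definition velocity :: "'a surface \<Rightarrow> real set \<Rightarrow> (real \<Rightarrow> 'a) \<Rightarrow> real \<Rightarrow> 'a tangent" where
  "velocity S J \<gamma> t =
     (\<lambda>c. if c \<in> charts_at S (\<gamma> t) then vector_derivative (snd c \<circ> \<gamma>) (at t within J) else 0)"

text \<open>The geodesic equation \<open>\<nabla>\<^sub>z\<^sub>' z' = 0\<close>, tested against all \<open>a\<close>.\<close>

definition geodesic :: "('a::t2_space) surface \<Rightarrow> real set \<Rightarrow> (real \<Rightarrow> 'a) \<Rightarrow> bool" where
  "geodesic S J \<gamma> \<longleftrightarrow>
     \<gamma> ` J \<subseteq> points S \<and> continuous_on J \<gamma> \<and>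
     (\<forall>t\<in>J. \<forall>c\<in>charts_at S (\<gamma> t).
        (\<forall>\<^sub>F s in at t within J. snd c \<circ> \<gamma> differentiable at s within J) \<and>
        snd c \<circ> \<gamma> differentiable at t within J \<and>
        (\<exists>z2. ((\<lambda>s. velocity S J \<gamma> s c) has_vector_derivative z2) (at t within J) \<and>
              (\<forall>a. local_metric S c (snd c (\<gamma> t)) z2 a
                   + christoffel S c (snd c (\<gamma> t)) (velocity S J \<gamma> t c) (velocity S J \<gamma> t c) a
                   = 0)))"

definition geodesic_from ::
  "('a::t2_space) surface \<Rightarrow> 'a \<Rightarrow> 'a tangent \<Rightarrow> real \<Rightarrow> (real \<Rightarrow> 'a) \<Rightarrow> bool" where
  "geodesic_from S x v T \<gamma> \<longleftrightarrow>
     0 < T \<and> geodesic S {0..T} \<gamma> \<and> \<gamma> 0 = x \<and> velocity S {0..T} \<gamma> 0 = v"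

text \<open>Every unit speed geodesic reaches the boundary in finite time. Geodesics issued from a
  boundary point are there at time 0.\<close>

definition nontrapping :: "('a::t2_space) surface \<Rightarrow> bool" where
  "nontrapping S \<longleftrightarrow>
     (\<forall>(x, v)\<in>unit_bundle S. x \<notin> boundary S \<longrightarrow>
        (\<exists>T \<gamma>. geodesic_from S x v T \<gamma> \<and> \<gamma> T \<in> boundary S))"

text \<open>First positive hitting time of the boundary. It is 0 if no hitting time exists; on
  \<open>\<partial>\<^sub>+SM\<close> (non-trapping surface with strictly convex boundary) this happens exactly for vectors
  tangent to the boundary, whose geodesics leave the surface at once.\<close>

definition exit_time :: "('a::t2_space) surface \<Rightarrow> 'a \<times> 'a tangent \<Rightarrow> real" where
  "exit_time S q =
     (let H = {t. \<exists>\<gamma>. geodesic_from S (fst q) (snd q) t \<gamma> \<and> \<gamma> t \<in> boundary S}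
      in if H = {} then 0 else Inf H)"

text \<open>Geodesic flow for times \<open>t \<ge> 0\<close>; well defined as long as the geodesic stays in the surface.\<close>

definition flow :: "('a::t2_space) surface \<Rightarrow> real \<Rightarrow> 'a \<times> 'a tangent \<Rightarrow> 'a \<times> 'a tangent" where
  "flow S t q =
     (if t = 0 then q
      else (THE r. \<exists>\<gamma>. geodesic_from S (fst q) (snd q) t \<gamma> \<and> r = (\<gamma> t, velocity S {0..t} \<gamma> t)))"


section \<open>Global isothermal coordinates\<close>

text \<open>The plane \<open>(x\<^sub>1, x\<^sub>2)\<close> is identified with the complex numbers, so that the inner product below
  is \<open>dx\<^sub>1\<^sup>2 + dx\<^sub>2\<^sup>2\<close>. The surface carries the orientation for which \<open>X\<close> is positive.\<close>

definition diff :: "'a surface \<Rightarrow> ('a \<Rightarrow> complex) \<Rightarrow> 'a \<Rightarrow> 'a tangent \<Rightarrow> complex" where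
  "diff S X p v = (let c = (SOME c. c \<in> charts_at S p) in chart_deriv c p X (v c))"

definition isothermal_coords :: "'a surface \<Rightarrow> ('a \<Rightarrow> complex) \<Rightarrow> ('a \<Rightarrow> real) \<Rightarrow> bool" where
  "isothermal_coords S X lam \<longleftrightarrow>
     inj_on X (points S) \<and>
     (\<forall>c\<in>charts S. smooth_on (snd c ` fst c) (X \<circ> chart_inv c) \<and>
                   smooth_on (snd c ` fst c) (lam \<circ> chart_inv c)) \<and>
     (\<forall>p\<in>points S. \<forall>u\<in>tangent_space S p. \<forall>v\<in>tangent_space S p.
        metric S p u v = exp (2 * lam p) * (diff S X p u \<bullet> diff S X p v))"

text \<open>\<open>frame_vec S X p a\<close> is \<open>Re a \<partial>\<^sub>1 + Im a \<partial>\<^sub>2\<close> at \<open>p\<close>.\<close>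

definition frame_vec :: "'a surface \<Rightarrow> ('a \<Rightarrow> complex) \<Rightarrow> 'a \<Rightarrow> complex \<Rightarrow> 'a tangent" where
  "frame_vec S X p a = (THE v. v \<in> tangent_space S p \<and> diff S X p v = a)"

definition unit_vec ::
  "'a surface \<Rightarrow> ('a \<Rightarrow> complex) \<Rightarrow> ('a \<Rightarrow> real) \<Rightarrow> 'a \<Rightarrow> real \<Rightarrow> 'a tangent" where
  "unit_vec S X lam p \<theta> = frame_vec S X p (exp (- lam p) *\<^sub>R cis \<theta>)"

definition angle :: "'a surface \<Rightarrow> ('a \<Rightarrow> complex) \<Rightarrow> 'a \<times> 'a tangent \<Rightarrow> real" where
  "angle S X q = Arg (diff S X (fst q) (snd q))"

text \<open>Direct rotation by \<open>\<pi>/2\<close>; it is multiplication by \<open>\<i>\<close> because \<open>X\<close> is conformal.\<close>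

definition perp :: "'a surface \<Rightarrow> ('a \<Rightarrow> complex) \<Rightarrow> 'a \<Rightarrow> 'a tangent \<Rightarrow> 'a tangent" where
  "perp S X p v = frame_vec S X p (\<i> * diff S X p v)"

text \<open>The function \<open>h e\<^sup>i\<^sup>k\<^sup>\<theta>\<close> on \<open>SM\<close>.\<close>

definition fibre_mode ::
  "'a surface \<Rightarrow> ('a \<Rightarrow> complex) \<Rightarrow> int \<Rightarrow> ('a \<Rightarrow> complex) \<Rightarrow> 'a \<times> 'a tangent \<Rightarrow> complex" where
  "fibre_mode S X k h q = h (fst q) * cis (of_int k * angle S X q)"


section \<open>Measures and square integrable functions\<close>

text \<open>The volume \<open>e\<^sup>2\<^sup>\<lambda> dx\<^sub>1 dx\<^sub>2\<close> on \<open>M\<close> and \<open>e\<^sup>2\<^sup>\<lambda> dx\<^sub>1 dx\<^sub>2 d\<theta>\<close> on \<open>SM\<close>.\<close>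

definition volume :: "'a surface \<Rightarrow> ('a \<Rightarrow> complex) \<Rightarrow> ('a \<Rightarrow> real) \<Rightarrow> 'a measure" where
  "volume S X lam =
     (let Y = inv_into (points S) X in
      embed_measure
        (density (lebesgue_on (X ` points S)) (\<lambda>z. ennreal (exp (2 * lam (Y z))))) Y)"

definition liouville ::
  "'a surface \<Rightarrow> ('a \<Rightarrow> complex) \<Rightarrow> ('a \<Rightarrow> real) \<Rightarrow> ('a \<times> 'a tangent) measure" where
  "liouville S X lam =
     (let Y = inv_into (points S) X in
      embed_measure
        (density (lebesgue_on (X ` points S \<times> {0..<2 * pi}))
                 (\<lambda>(z, \<theta>). ennreal (exp (2 * lam (Y z)))))
        (\<lambda>(z, \<theta>). (Y z, unit_vec S X lam (Y z) \<theta>)))"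

text \<open>The arc length measure on the boundary, characterised in charts by \<open>ds = \<surd>g\<^sub>1\<^sub>1 dx\<^sub>1\<close>.\<close>

definition boundary_length :: "('a::t2_space) surface \<Rightarrow> 'a measure" where
  "boundary_length S =
     (THE \<mu>. sets \<mu> = sets (restrict_space borel (boundary S)) \<and>
        (\<forall>c\<in>charts S. \<forall>A\<in>sets \<mu>. A \<subseteq> fst c \<longrightarrow>
           emeasure \<mu> A = (\<integral>\<^sup>+s\<in>(\<lambda>p. Re (snd c p)) ` A.
             ennreal (sqrt (local_metric S c (complex_of_real s) 1 1)) \<partial>lborel)))"

text \<open>The measure \<open>ds d\<theta>\<close> on \<open>\<partial>\<^sub>+SM\<close>.\<close>

definition influx_measure ::
  "('a::t2_space) surface \<Rightarrow> ('a \<Rightarrow> complex) \<Rightarrow> ('a \<Rightarrow> real) \<Rightarrow> ('a \<times> 'a tangent) measure" where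
  "influx_measure S X lam =
     restrict_space
       (embed_measure
         (completion (boundary_length S \<Otimes>\<^sub>M restrict_space lborel {0..<2 * pi}))
         (\<lambda>(x, \<theta>). (x, unit_vec S X lam x \<theta>)))
       (influx S)"

text \<open>Representatives of elements of \<open>L\<^sup>2\<close>.\<close>

definition L2 :: "'b measure \<Rightarrow> ('b \<Rightarrow> complex) set" where
  "L2 \<mu> = {F. F \<in> borel_measurable \<mu> \<and> integrable \<mu> (\<lambda>x. (cmod (F x))\<^sup>2)}"


section \<open>Weighted ray transforms\<close>

definition ray_transform ::
  "('a::t2_space) surface \<Rightarrow> ('a \<times> 'a tangent \<Rightarrow> complex) \<Rightarrow>
   ('a \<times> 'a tangent \<Rightarrow> complex) \<Rightarrow> 'a \<times> 'a tangent \<Rightarrow> complex" where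
  "ray_transform S w F q =
     (LINT t:{0..exit_time S q}|lebesgue. w (flow S t q) * F (flow S t q))"

text \<open>Well-definedness on \<open>L\<^sup>2\<close>: the integral exists along almost every geodesic, its class does
  not depend on the representative of the integrand, and it is square integrable.\<close>

definition weight ::
  "('a::t2_space) surface \<Rightarrow> ('a \<Rightarrow> complex) \<Rightarrow> ('a \<Rightarrow> real) \<Rightarrow>
   ('a \<times> 'a tangent \<Rightarrow> complex) \<Rightarrow> bool" where
  "weight S X lam w \<longleftrightarrow>
     (\<forall>q\<in>unit_bundle S. w q \<noteq> 0) \<and>
     (\<forall>F\<in>L2 (liouville S X lam).
        (AE q in influx_measure S X lam.
           set_integrable lebesgue {0..exit_time S q} (\<lambda>t. w (flow S t q) * F (flow S t q))) \<and>
        ray_transform S w F \<in> L2 (influx_measure S X lam) \<and>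
        (\<forall>F'\<in>L2 (liouville S X lam). (AE q in liouville S X lam. F q = F' q) \<longrightarrow>
           (AE q in influx_measure S X lam. ray_transform S w F q = ray_transform S w F' q)))"

text \<open>Injectivity of \<open>L\<^sup>2(M) \<ni> h \<mapsto> I\<^sub>w[h e\<^sup>i\<^sup>k\<^sup>\<theta>]\<close>.\<close>

definition scalar_transform_injective ::
  "('a::t2_space) surface \<Rightarrow> ('a \<Rightarrow> complex) \<Rightarrow> ('a \<Rightarrow> real) \<Rightarrow>
   ('a \<times> 'a tangent \<Rightarrow> complex) \<Rightarrow> int \<Rightarrow> bool" where
  "scalar_transform_injective S X lam w k \<longleftrightarrow>
     (\<forall>h\<in>L2 (volume S X lam). \<forall>h'\<in>L2 (volume S X lam).
        (AE q in influx_measure S X lam.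
           ray_transform S w (fibre_mode S X k h) q = ray_transform S w (fibre_mode S X k h') q)
        \<longrightarrow> (AE x in volume S X lam. h x = h' x))"


section \<open>Symmetric tensors\<close>

text \<open>A field of complex-valued symmetric covariant \<open>m\<close>-tensors takes a point and a list of \<open>m\<close>
  tangent vectors at this point; its values at other arguments are irrelevant.\<close>

type_synonym 'a tensor_field = "'a \<Rightarrow> 'a tangent list \<Rightarrow> complex"

definition tangent_lists :: "'a surface \<Rightarrow> nat \<Rightarrow> 'a \<Rightarrow> 'a tangent list set" where
  "tangent_lists S m p = {vs. length vs = m \<and> set vs \<subseteq> tangent_space S p}"

definition smooth_symmetric_tensor :: "'a surface \<Rightarrow> nat \<Rightarrow> 'a tensor_field \<Rightarrow> bool" where
  "smooth_symmetric_tensor S m f \<longleftrightarrow>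
     (\<forall>p\<in>points S. \<forall>vs\<in>tangent_lists S m p.
        (\<forall>us. mset us = mset vs \<longrightarrow> f p us = f p vs) \<and>
        (\<forall>i<m. \<forall>u\<in>tangent_space S p. \<forall>v\<in>tangent_space S p. \<forall>r::real.
           f p (vs[i := (\<lambda>c. r *\<^sub>R u c + v c)])
           = of_real r * f p (vs[i := u]) + f p (vs[i := v]))) \<and>
     (\<forall>c\<in>charts S. \<forall>as. length as = m \<longrightarrow>
        smooth_on (snd c ` fst c)
          (\<lambda>z. f (chart_inv c z) (map (coord_vec S c (chart_inv c z)) as)))"

text \<open>\<open>\<ell>\<^sub>m\<^sub>,\<^sub>k f\<close>\<close>

definition transverse ::
  "'a surface \<Rightarrow> ('a \<Rightarrow> complex) \<Rightarrow> nat \<Rightarrow> nat \<Rightarrow> 'a tensor_field \<Rightarrow> 'a \<times> 'a tangent \<Rightarrow> complex" where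
  "transverse S X m k f q =
     f (fst q) (replicate (m - k) (snd q) @ replicate k (perp S X (fst q) (snd q)))"

end

theory Submission
  imports Defs
begin

text \<open>
  Let \<open>v\<close> be the unit vector with angle \<open>\<theta>\<close>. In the complexified tangent plane the two
  vectors \<open>v \<plusminus> \<i> v\<^sup>\<bottom>\<close> are isotropic, and they are the corresponding vectors for \<open>\<theta> = 0\<close>
  multiplied by \<open>e\<^sup>\<minusplus>\<^sup>\<i>\<^sup>\<theta>\<close>. Evaluate the complex multilinear extension of a symmetric
  \<open>m\<close>-tensor \<open>f\<close> on \<open>m\<close> such vectors with signs \<open>s\<^sub>1, \<dots>, s\<^sub>m\<close>. On the one hand the result is
  \<open>h(x) e\<^sup>\<i>\<^sup>k\<^sup>\<theta>\<close> with \<open>k = - (s\<^sub>1 + \<dots> + s\<^sub>m)\<close>, so \<open>|k| \<le> m\<close> and \<open>m - k\<close> is even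
  (\<open>null_contraction_rotate\<close>). On the other hand, expanding it and using symmetry gives a
  combination of the functions \<open>\<ell>\<^sub>m\<^sub>,\<^sub>k f\<close>, whose coefficients depend only on the signs
  (\<open>null_contraction_expand\<close>). By linearity of the ray transform (\<open>ray_transform_sum\<close>) the data
  therefore determine \<open>I\<^sub>w[h e\<^sup>\<i>\<^sup>k\<^sup>\<theta>]\<close>, and injectivity of the scalar transforms determines \<open>h\<close>
  almost everywhere. As \<open>h\<close> is continuous, it is determined everywhere (\<open>AE_volume_imp_eq\<close>).
  Isotropic vectors span the complexified tangent plane, so all these \<open>h\<close> together determine
  \<open>f\<close> (\<open>multilinear_form_eqI\<close>).

  Two points need care. The combination above is an identity on the unit tangent bundle only,
  whereas a ray transform sees the values of its integrand wherever \<open>flow\<close> leads. Since a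
  weight makes the transform well defined on classes of functions modulo the Liouville measure,
  which lives on the unit tangent bundle, the identity may be used as if it held everywhere.
  Moreover, all functions involved have to be square integrable and \<open>h\<close> has to be continuous
  up to the boundary. Both follow from continuity of \<open>f\<close> in the isothermal frame
  (\<open>continuous_on_frame_form\<close>), which is expressed in a chart by inverting the Jacobian matrix of
  \<open>X\<close>. That matrix is invertible because the metric is the positive definite pullback under \<open>X\<close>
  of a multiple of the Euclidean one.
\<close>

section \<open>Real-multilinear forms on the plane\<close>

text \<open>A tangent vector at a fixed point is represented by a complex number, its components in the
  isothermal orthonormal frame; the rotation by \<open>\<pi>/2\<close> is then multiplication by \<open>\<i>\<close>.
  The forms are complex-valued but only real-multilinear, and lists of any other length
  than \<open>n\<close> are unconstrained.\<close>

definition multilinear_form :: "nat \<Rightarrow> (complex list \<Rightarrow> complex) \<Rightarrow> bool" where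
  "multilinear_form n \<Phi> \<longleftrightarrow>
     (\<forall>us a b vs. \<forall>r::real. Suc (length us + length vs) = n \<longrightarrow>
        \<Phi> (us @ (r *\<^sub>R a + b) # vs) = of_real r * \<Phi> (us @ a # vs) + \<Phi> (us @ b # vs))"

definition symmetric_form :: "nat \<Rightarrow> (complex list \<Rightarrow> complex) \<Rightarrow> bool" where
  "symmetric_form n \<Phi> \<longleftrightarrow>
     (\<forall>us vs. length vs = n \<longrightarrow> mset us = mset vs \<longrightarrow> \<Phi> us = \<Phi> vs)"

text \<open>The complex multilinear extension of \<open>\<Phi>\<close>, evaluated on the isotropic vectors
  \<open>z \<otimes> 1 + (\<i> z) \<otimes> s \<i>\<close> in the complexification of the plane, for the signs \<open>s\<close> in the list.
  Recursion on the signs expands one argument after the other and so avoids constructing the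
  complexification.\<close>

primrec null_contraction :: "complex \<Rightarrow> int list \<Rightarrow> (complex list \<Rightarrow> complex) \<Rightarrow> complex" where
  "null_contraction z [] \<Phi> = \<Phi> []"
| "null_contraction z (s # ss) \<Phi> =
     null_contraction z ss (\<lambda>vs. \<Phi> (z # vs) + \<i> * of_int s * \<Phi> ((\<i> * z) # vs))"

lemma multilinear_form_Cons_linear:
  assumes "multilinear_form (Suc n) \<Phi>" "length vs = n"
  shows "\<Phi> ((r *\<^sub>R a + b) # vs) = of_real r * \<Phi> (a # vs) + \<Phi> (b # vs)"
  using assms unfolding multilinear_form_def
  by (metis append_Nil list.size(3) add_0)

lemma multilinear_form_Cons_coords:
  assumes "multilinear_form (Suc n) \<Phi>" "length vs = n"
  shows "\<Phi> (a # vs) = of_real (Re a) * \<Phi> (1 # vs) + of_real (Im a) * \<Phi> (\<i> # vs)"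
proof -
  have zero: "\<Phi> (0 # vs) = 0"
    using multilinear_form_Cons_linear[OF assms, of 1 0 0] by simp
  have "a = Re a *\<^sub>R 1 + (Im a *\<^sub>R \<i> + 0)"
    by (simp add: complex_eq_iff)
  then show ?thesis
    using multilinear_form_Cons_linear[OF assms] zero by (metis add.right_neutral)
qed

lemma multilinear_form_Cons:
  assumes "multilinear_form (Suc n) \<Phi>"
  shows "multilinear_form n (\<lambda>vs. \<Phi> (a # vs))"
  using assms unfolding multilinear_form_def
  by (metis append_Cons length_Cons add_Suc)

lemma multilinear_form_lincomb:
  assumes "multilinear_form n \<Phi>" "multilinear_form n \<Psi>"
  shows "multilinear_form n (\<lambda>vs. \<Phi> vs + c * \<Psi> vs)"
  using assms unfolding multilinear_form_def by (simp add: algebra_simps)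

lemma multilinear_form_contract:
  assumes "multilinear_form (Suc n) \<Phi>"
  shows "multilinear_form n (\<lambda>vs. \<Phi> (a # vs) + c * \<Phi> (b # vs))"
  by (intro multilinear_form_lincomb multilinear_form_Cons assms)

lemma null_contraction_cong:
  assumes "\<And>vs. length vs = length ss \<Longrightarrow> \<Phi> vs = \<Psi> vs"
  shows "null_contraction z ss \<Phi> = null_contraction z ss \<Psi>"
  using assms
proof (induction ss arbitrary: \<Phi> \<Psi>)
  case (Cons s ss)
  show ?case
    unfolding null_contraction.simps by (rule Cons.IH) (simp add: Cons.prems)
qed simp

lemma null_contraction_scale:
  "null_contraction z ss (\<lambda>vs. c * \<Phi> vs) = c * null_contraction z ss \<Phi>"
proof (induction ss arbitrary: \<Phi>)
  case (Cons s ss)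
  have "(\<lambda>vs. c * \<Phi> (z # vs) + \<i> * of_int s * (c * \<Phi> ((\<i> * z) # vs)))
      = (\<lambda>vs. c * (\<Phi> (z # vs) + \<i> * of_int s * \<Phi> ((\<i> * z) # vs)))"
    by (simp add: algebra_simps)
  then show ?case
    by (simp only: null_contraction.simps Cons.IH)
qed simp

text \<open>Complex multiples come out of a complex multilinear form, and \<open>z\<close> enters through the vector
  \<open>z \<otimes> 1 + (\<i> z) \<otimes> s \<i>\<close>. For \<open>z = cos t + \<i> sin t\<close> this equals \<open>cos t - s \<i> sin t\<close> times the
  vector for \<open>z = 1\<close>, because \<open>s\<^sup>2 = 1\<close>. Each sign contributes such a factor.\<close>

lemma null_contraction_rotate:
  assumes "set ss \<subseteq> {1, -1}" "multilinear_form (length ss) \<Phi>"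
  shows "null_contraction (cis t) ss \<Phi>
    = cis (of_int (- sum_list ss) * t) * null_contraction 1 ss \<Phi>"
  using assms
proof (induction ss arbitrary: \<Phi>)
  case (Cons s ss)
  define \<Psi> where "\<Psi> = (\<lambda>vs. \<Phi> (1 # vs) + \<i> * of_int s * \<Phi> (\<i> # vs))"
  have ml: "multilinear_form (Suc (length ss)) \<Phi>" using Cons.prems by simp
  have step: "\<Phi> (cis t # vs) + \<i> * of_int s * \<Phi> ((\<i> * cis t) # vs)
      = cis (of_int (- s) * t) * \<Psi> vs" if "length vs = length ss" for vs
  proof -
    have s: "s = 1 \<or> s = -1" using Cons.prems by auto
    have e: "cis (of_int (- s) * t) = of_real (cos t) - \<i> * of_int s * of_real (sin t)"
      using s by (auto simp: complex_eq_iff)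
    show ?thesis
      unfolding e \<Psi>_def
        multilinear_form_Cons_coords[OF ml that, of "cis t"]
        multilinear_form_Cons_coords[OF ml that, of "\<i> * cis t"]
      using s by (auto simp: algebra_simps)
  qed
  have "null_contraction (cis t) (s # ss) \<Phi>
      = null_contraction (cis t) ss (\<lambda>vs. cis (of_int (- s) * t) * \<Psi> vs)"
    unfolding null_contraction.simps by (rule null_contraction_cong) (rule step)
  also have "\<dots> = cis (of_int (- s) * t) * null_contraction (cis t) ss \<Psi>"
    by (rule null_contraction_scale)
  also have "null_contraction (cis t) ss \<Psi>
      = cis (of_int (- sum_list ss) * t) * null_contraction 1 ss \<Psi>"
    using Cons.prems
    by (intro Cons.IH) (auto simp: \<Psi>_def intro: multilinear_form_contract)
  also have "cis (of_int (- s) * t) * (cis (of_int (- sum_list ss) * t) * null_contraction 1 ss \<Psi>)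
      = cis (of_int (- s) * t + of_int (- sum_list ss) * t) * null_contraction 1 ss \<Psi>"
    by (simp only: cis_mult mult.assoc[symmetric])
  also have "of_int (- s) * t + of_int (- sum_list ss) * t = of_int (- sum_list (s # ss)) * t"
    by (simp add: algebra_simps)
  finally show ?case
    by (simp add: \<Psi>_def)
qed simp

text \<open>Multiplying out the \<open>m\<close> arguments gives terms in which some slots hold \<open>z\<close> and the others
  \<open>\<i> z\<close>; by symmetry only the number \<open>k\<close> of the latter counts. It matters that the coefficients
  \<open>e\<close> do not depend on \<open>z\<close> and \<open>\<Phi>\<close>: they will be the same at all points and for both tensors.\<close>

lemma null_contraction_expand:
  "\<exists>e. \<forall>z \<Phi>. symmetric_form (length ss) \<Phi> \<longrightarrow>
     null_contraction z ss \<Phi>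
       = (\<Sum>k\<le>length ss. e k * \<Phi> (replicate (length ss - k) z @ replicate k (\<i> * z)))"
proof (induction ss)
  case Nil
  show ?case by (rule exI[of _ "\<lambda>_. 1"]) simp
next
  case (Cons s ss)
  let ?n = "length ss"
  obtain e where e: "\<And>z \<Phi>. symmetric_form ?n \<Phi> \<Longrightarrow>
      null_contraction z ss \<Phi>
        = (\<Sum>k\<le>?n. e k * \<Phi> (replicate (?n - k) z @ replicate k (\<i> * z)))"
    using Cons.IH by blast
  define e' where "e' k = (if k \<le> ?n then e k else 0)
      + (if k = 0 then 0 else \<i> * of_int s * e (k - 1))" for k
  have "null_contraction z (s # ss) \<Phi>
      = (\<Sum>k\<le>Suc ?n. e' k * \<Phi> (replicate (Suc ?n - k) z @ replicate k (\<i> * z)))"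
    if sym: "symmetric_form (Suc ?n) \<Phi>" for z \<Phi>
  proof -
    let ?T = "\<lambda>k. \<Phi> (replicate (Suc ?n - k) z @ replicate k (\<i> * z))"
    have "symmetric_form ?n (\<lambda>vs. \<Phi> (z # vs) + \<i> * of_int s * \<Phi> ((\<i> * z) # vs))"
      using sym unfolding symmetric_form_def by (metis length_Cons mset.simps(2))
    then have "null_contraction z (s # ss) \<Phi>
      = (\<Sum>k\<le>?n. e k * (\<Phi> (z # replicate (?n - k) z @ replicate k (\<i> * z))
          + \<i> * of_int s * \<Phi> ((\<i> * z) # replicate (?n - k) z @ replicate k (\<i> * z))))"
      by (simp add: e)
    also have "\<dots> = (\<Sum>k\<le>?n. e k * ?T k + \<i> * of_int s * e k * ?T (Suc k))"
    proof (rule sum.cong[OF refl])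
      fix k assume "k \<in> {..?n}"
      then have k: "k \<le> ?n" by simp
      have 1: "z # replicate (?n - k) z @ replicate k (\<i> * z)
          = replicate (Suc ?n - k) z @ replicate k (\<i> * z)"
        using k by (simp add: Suc_diff_le)
      have 2: "\<Phi> ((\<i> * z) # replicate (?n - k) z @ replicate k (\<i> * z)) = ?T (Suc k)"
        using sym k unfolding symmetric_form_def by simp
      show "e k * (\<Phi> (z # replicate (?n - k) z @ replicate k (\<i> * z))
          + \<i> * of_int s * \<Phi> ((\<i> * z) # replicate (?n - k) z @ replicate k (\<i> * z)))
        = e k * ?T k + \<i> * of_int s * e k * ?T (Suc k)"
        unfolding 1 2 by (simp add: algebra_simps)
    qed
    also have "\<dots> = (\<Sum>k\<le>?n. e k * ?T k) + (\<Sum>k\<le>?n. \<i> * of_int s * e k * ?T (Suc k))"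
      by (rule sum.distrib)
    also have "(\<Sum>k\<le>?n. e k * ?T k) = (\<Sum>k\<le>Suc ?n. (if k \<le> ?n then e k else 0) * ?T k)"
      by simp
    also have "(\<Sum>k\<le>?n. \<i> * of_int s * e k * ?T (Suc k))
        = (\<Sum>k\<le>Suc ?n. (if k = 0 then 0 else \<i> * of_int s * e (k - 1)) * ?T k)"
      unfolding sum.atMost_Suc_shift[of _ ?n] by simp
    also have "(\<Sum>k\<le>Suc ?n. (if k \<le> ?n then e k else 0) * ?T k)
        + (\<Sum>k\<le>Suc ?n. (if k = 0 then 0 else \<i> * of_int s * e (k - 1)) * ?T k)
        = (\<Sum>k\<le>Suc ?n. e' k * ?T k)"
      unfolding e'_def sum.distrib[symmetric] by (simp only: distrib_right)
    finally show ?thesis .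
  qed
  then show ?case by auto
qed

text \<open>The isotropic vectors for \<open>s = 1\<close> and \<open>s = -1\<close> form a basis of the complexified plane, so the values
  on them determine the form. In the induction the two vectors are put into the first slot, and
  half their sum and half their difference isolate the arguments \<open>1\<close> and \<open>\<i>\<close>.\<close>

lemma multilinear_form_eqI:
  assumes "multilinear_form n \<Phi>" "multilinear_form n \<Psi>"
    and "\<And>ss. length ss = n \<Longrightarrow> set ss \<subseteq> {1, -1} \<Longrightarrow>
           null_contraction 1 ss \<Phi> = null_contraction 1 ss \<Psi>"
    and "length vs = n"
  shows "\<Phi> vs = \<Psi> vs"
  using assms
proof (induction n arbitrary: \<Phi> \<Psi> vs)
  case 0
  then show ?case using "0.prems"(3)[of "[]"] by simp
next
  case (Suc n)
  have eq: "\<Phi> (1 # us) + \<i> * of_int s * \<Phi> (\<i> # us) = \<Psi> (1 # us) + \<i> * of_int s * \<Psi> (\<i> # us)"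
    if s: "s \<in> {1, -1}" and us: "length us = n" for s :: int and us
  proof (rule Suc.IH[of "\<lambda>us. \<Phi> (1 # us) + \<i> * of_int s * \<Phi> (\<i> # us)"
                        "\<lambda>us. \<Psi> (1 # us) + \<i> * of_int s * \<Psi> (\<i> # us)" us])
    fix ss :: "int list"
    assume ss: "length ss = n" "set ss \<subseteq> {1, -1}"
    show "null_contraction 1 ss (\<lambda>us. \<Phi> (1 # us) + \<i> * of_int s * \<Phi> (\<i> # us))
        = null_contraction 1 ss (\<lambda>us. \<Psi> (1 # us) + \<i> * of_int s * \<Psi> (\<i> # us))"
      using Suc.prems(3)[of "s # ss"] ss s by simp
  qed (use Suc.prems us in \<open>auto intro: multilinear_form_contract\<close>)
  obtain a us where vs: "vs = a # us" and us: "length us = n"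
    using Suc.prems(4) by (cases vs) auto
  have sum: "\<Phi> (1 # us) + \<i> * \<Phi> (\<i> # us) = \<Psi> (1 # us) + \<i> * \<Psi> (\<i> # us)"
    and diff: "\<Phi> (1 # us) - \<i> * \<Phi> (\<i> # us) = \<Psi> (1 # us) - \<i> * \<Psi> (\<i> # us)"
    using eq[of 1 us] eq[of "-1" us] us by simp_all
  have one: "\<Phi> (1 # us) = \<Psi> (1 # us)"
    using arg_cong2[OF sum diff, of "(+)"] by simp
  then have "\<Phi> (\<i> # us) = \<Psi> (\<i> # us)"
    using sum by simp
  then show ?case
    using one multilinear_form_Cons_coords[OF Suc.prems(1) us, of a]
      multilinear_form_Cons_coords[OF Suc.prems(2) us, of a] vs by simp
qed

text \<open>Both the form and its arguments may depend on the parameter \<open>q\<close>. Expanding in the basis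
  \<open>1\<close>, \<open>\<i>\<close> reduces this to constant arguments.\<close>

lemma continuous_on_multilinear_form:
  assumes "\<And>q. q \<in> A \<Longrightarrow> multilinear_form (length as) (\<Phi> q)"
    and "\<And>bs. length bs = length as \<Longrightarrow> continuous_on A (\<lambda>q. \<Phi> q bs)"
    and "\<And>a. a \<in> set as \<Longrightarrow> continuous_on A a"
  shows "continuous_on A (\<lambda>q. \<Phi> q (map (\<lambda>a. a q) as))"
  using assms
proof (induction as arbitrary: \<Phi>)
  case Nil
  then show ?case by simp
next
  case (Cons a as)
  have *: "continuous_on A (\<lambda>q. \<Phi> q (b # map (\<lambda>a. a q) as))" for b
    using Cons.IH[of "\<lambda>q vs. \<Phi> q (b # vs)"] Cons.prems
    by (auto intro: multilinear_form_Cons)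
  have "continuous_on A (\<lambda>q. of_real (Re (a q)) * \<Phi> q (1 # map (\<lambda>a. a q) as)
      + of_real (Im (a q)) * \<Phi> q (\<i> # map (\<lambda>a. a q) as))"
    using Cons.prems by (intro continuous_intros *) auto
  moreover have "\<Phi> q (map (\<lambda>a. a q) (a # as))
      = of_real (Re (a q)) * \<Phi> q (1 # map (\<lambda>a. a q) as)
      + of_real (Im (a q)) * \<Phi> q (\<i> # map (\<lambda>a. a q) as)" if "q \<in> A" for q
    using multilinear_form_Cons_coords[of "length as" "\<Phi> q" "map (\<lambda>a. a q) as" "a q"]
      Cons.prems(1)[OF that] by simp
  ultimately show ?case
    by (simp cong: continuous_on_cong)
qed

section \<open>Calculus on the half plane\<close>

lemma frechet_derivative_half_plane:
  assumes D: "(F has_derivative D) (at z within half_plane)" and z: "z \<in> half_plane"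
  shows "frechet_derivative F (at z within half_plane) = D"
proof (rule frechet_derivative_unique_within)
  show "(F has_derivative frechet_derivative F (at z within half_plane)) (at z within half_plane)"
    unfolding frechet_derivative_works[symmetric] using D by (rule differentiableI)
  fix i :: complex and e :: real
  assume i: "i \<in> Basis" and e: "e > 0"
  show "\<exists>d. 0 < \<bar>d\<bar> \<and> \<bar>d\<bar> < e \<and> z + d *\<^sub>R i \<in> half_plane"
    by (rule exI[of _ "e / 2"]) (use i e z in \<open>auto simp: Basis_complex_def half_plane_def\<close>)
qed (rule D)

lemma at_within_half_plane:
  assumes "openin (top_of_set half_plane) A" "z \<in> A" "open W" "z \<in> W"
  shows "at z within half_plane = at z within (A \<inter> W)"
proof -
  obtain T where T: "open T" "A = half_plane \<inter> T"
    using assms(1) by (auto simp: openin_open)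
  show ?thesis
    by (rule at_within_nhd[where S = "T \<inter> W"]) (use assms T in auto)
qed

text \<open>Charts take values in the half plane, so near a boundary point a smooth function is only known
  on one side. By uniqueness of derivatives within the half plane, the one-sided derivative is that of
  any local smooth extension; this gives existence and continuity at once.\<close>

lemma smooth_on_half_plane:
  assumes F: "smooth_on A F" and A: "openin (top_of_set half_plane) A"
  shows smooth_on_has_derivative: "z \<in> A \<Longrightarrow>
      (F has_derivative frechet_derivative F (at z within half_plane)) (at z within half_plane)"
    and smooth_on_continuous_deriv:
      "continuous_on A (\<lambda>z. frechet_derivative F (at z within half_plane) a)"
proof -
  have sub: "A \<subseteq> half_plane" using openin_imp_subset[OF A] by simp
  have loc: "\<exists>W G. open W \<and> z \<in> W \<and> continuous_on W (\<lambda>y. frechet_derivative G (at y) a) \<and>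
      (\<forall>y\<in>A \<inter> W. (F has_derivative frechet_derivative G (at y)) (at y within half_plane))"
    if z: "z \<in> A" for z a
  proof -
    obtain W G where W: "open W" "z \<in> W" "\<And>k. Ck_on k G W" "\<And>y. y \<in> A \<inter> W \<Longrightarrow> G y = F y"
      using bspec[OF F[unfolded smooth_on_def] z] by auto
    have "Ck_on (Suc 0) G W" by (rule W(3))
    then have d: "G differentiable_on W" and c: "continuous_on W (\<lambda>y. frechet_derivative G (at y) a)"
      by simp_all
    have "(F has_derivative frechet_derivative G (at y)) (at y within half_plane)"
      if y: "y \<in> A \<inter> W" for y
    proof -
      have "G differentiable at y"
        using d y W(1) by (simp add: differentiable_on_eq_differentiable_at)
      then have "(G has_derivative frechet_derivative G (at y)) (at y within A \<inter> W)"
        unfolding frechet_derivative_works by (rule has_derivative_at_withinI)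
      then have "(F has_derivative frechet_derivative G (at y)) (at y within A \<inter> W)"
        by (rule has_derivative_transform[rotated 2]) (use y W(4) in auto)
      then show ?thesis using at_within_half_plane[OF A _ W(1)] y by auto
    qed
    then show ?thesis using W(1,2) c by blast
  qed
  show "(F has_derivative frechet_derivative F (at z within half_plane)) (at z within half_plane)"
    if z: "z \<in> A" for z
  proof -
    obtain W G where "z \<in> W"
      "\<forall>y\<in>A \<inter> W. (F has_derivative frechet_derivative G (at y)) (at y within half_plane)"
      using loc[OF z] by blast
    then have "(F has_derivative frechet_derivative G (at z)) (at z within half_plane)"
      using z by simp
    then show ?thesis
      unfolding frechet_derivative_works[symmetric] by (rule differentiableI)
  qed
  show "continuous_on A (\<lambda>z. frechet_derivative F (at z within half_plane) a)"
    unfolding continuous_on_eq_continuous_within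
  proof
    fix z assume z: "z \<in> A"
    obtain W G where W: "open W" "z \<in> W"
      and c: "continuous_on W (\<lambda>y. frechet_derivative G (at y) a)"
      and eqs: "\<forall>y\<in>A \<inter> W. (F has_derivative frechet_derivative G (at y)) (at y within half_plane)"
      using loc[OF z, of a] by (elim exE conjE)
    note eq = bspec[OF eqs]
    have "continuous_on (A \<inter> W) (\<lambda>z. frechet_derivative F (at z within half_plane) a)"
      by (rule continuous_on_eq[OF continuous_on_subset[OF c]])
        (use frechet_derivative_half_plane[OF eq] sub in auto)
    then have "continuous (at z within A \<inter> W) (\<lambda>z. frechet_derivative F (at z within half_plane) a)"
      using z W continuous_on_eq_continuous_within by blast
    moreover have "at z within A \<inter> W = at z within A"
      by (rule at_within_nhd[where S = W]) (use W in auto)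
    ultimately show "continuous (at z within A) (\<lambda>z. frechet_derivative F (at z within half_plane) a)"
      by (simp add: continuous_within)
  qed
qed

lemma smooth_on_imp_continuous_on:
  assumes "smooth_on A F"
  shows "continuous_on A F"
  unfolding continuous_on_eq_continuous_within
proof
  fix z assume z: "z \<in> A"
  obtain W G where W: "open W" "z \<in> W" "\<And>k. Ck_on k G W" "\<And>y. y \<in> A \<inter> W \<Longrightarrow> G y = F y"
    using bspec[OF assms[unfolded smooth_on_def] z] by auto
  have "Ck_on 0 G W" by (rule W(3))
  then have "continuous_on (A \<inter> W) F"
    using W(4) by (auto intro: continuous_on_eq continuous_on_subset)
  then have "continuous (at z within A \<inter> W) F"
    using z W continuous_on_eq_continuous_within by blast
  moreover have "at z within A \<inter> W = at z within A"
    by (rule at_within_nhd[where S = W]) (use W in auto)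
  ultimately show "continuous (at z within A) F"
    by (simp add: continuous_within)
qed


section \<open>Tangent vectors and the isothermal frame\<close>

locale isothermal_surface =
  fixes S :: "('a::t2_space) surface" and X :: "'a \<Rightarrow> complex" and lam :: "'a \<Rightarrow> real"
  assumes riemannian: "riemannian_surface S"
    and isothermal: "isothermal_coords S X lam"
begin

lemma surface: "smooth_surface S"
  using riemannian by (simp add: riemannian_surface_def)

lemma compact_points: "compact (points S)"
  using surface unfolding smooth_surface_def by (elim conjE)

lemma chart_at_exists:
  assumes "p \<in> points S"
  obtains c where "c \<in> charts_at S p"
proof -
  have "points S = (\<Union>c\<in>charts S. fst c)"
    using surface unfolding smooth_surface_def by (elim conjE)
  then show thesis
    using assms that by (auto simp: charts_at_def)
qed

lemma charts_atD:
  assumes "c \<in> charts_at S p"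
  shows "c \<in> charts S" "p \<in> fst c"
  using assms by (auto simp: charts_at_def)

lemma chart:
  assumes "c \<in> charts S"
  shows chart_openin_points: "openin (top_of_set (points S)) (fst c)"
    and chart_image_openin: "openin (top_of_set half_plane) (snd c ` fst c)"
    and chart_homeomorphism: "homeomorphism (fst c) (snd c ` fst c) (snd c) (chart_inv c)"
proof -
  have "\<forall>c\<in>charts S. openin (top_of_set (points S)) (fst c) \<and>
        openin (top_of_set half_plane) (snd c ` fst c) \<and>
        homeomorphism (fst c) (snd c ` fst c) (snd c) (chart_inv c)"
    using surface unfolding smooth_surface_def by (elim conjE)
  from bspec[OF this assms] show "openin (top_of_set (points S)) (fst c)"
    "openin (top_of_set half_plane) (snd c ` fst c)"
    "homeomorphism (fst c) (snd c ` fst c) (snd c) (chart_inv c)"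
    by - (elim conjE, assumption)+
qed

lemma chart_inv_chart: "c \<in> charts S \<Longrightarrow> p \<in> fst c \<Longrightarrow> chart_inv c (snd c p) = p"
  using chart_homeomorphism[of c] unfolding homeomorphism_def by simp

lemma chart_image_half_plane: "c \<in> charts S \<Longrightarrow> p \<in> fst c \<Longrightarrow> snd c p \<in> half_plane"
  using openin_imp_subset[OF chart_image_openin, of c] by auto

lemma chart_subset_points: "c \<in> charts S \<Longrightarrow> fst c \<subseteq> points S"
  using openin_imp_subset[OF chart_openin_points] by simp

lemma charts_at_points: "c \<in> charts_at S p \<Longrightarrow> p \<in> points S"
  using chart_subset_points charts_atD by blast

lemma chart_image_openin_sub:
  assumes "c \<in> charts S" "openin (top_of_set (points S)) U" "U \<subseteq> fst c"
  shows "openin (top_of_set half_plane) (snd c ` U)"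
proof -
  have "openin (top_of_set (fst c)) U"
    using openin_subset_trans[OF assms(2,3)] chart_subset_points[OF assms(1)] by simp
  then have "openin (top_of_set (snd c ` fst c)) (snd c ` U)"
    by (rule homeomorphism_imp_open_map[OF chart_homeomorphism[OF assms(1)]])
  then show ?thesis
    using chart_image_openin[OF assms(1)] by (rule openin_trans)
qed

lemma overlap_openin:
  assumes "c \<in> charts S" "d \<in> charts S"
  shows "openin (top_of_set half_plane) (snd c ` (fst c \<inter> fst d))"
  using assms by (intro chart_image_openin_sub openin_Int chart_openin_points) auto

lemma transition_has_derivative:
  assumes "c \<in> charts_at S p" "d \<in> charts_at S p"
  shows "((snd d \<circ> chart_inv c) has_derivative chart_deriv c p (snd d))
           (at (snd c p) within half_plane)"
  unfolding chart_deriv_def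
proof (rule smooth_on_has_derivative)
  show "smooth_on (snd c ` (fst c \<inter> fst d)) (snd d \<circ> chart_inv c)"
    using surface assms unfolding smooth_surface_def charts_at_def by blast
qed (use assms overlap_openin in \<open>auto simp: charts_at_def\<close>)

text \<open>The chain rule. The derivative of \<open>G\<close> is only required at the one point \<open>p\<close>, so that the lemma
  also applies to coordinate maps \<open>G\<close>, which are meaningful merely on an overlap of domains.\<close>

lemma chart_deriv_chain:
  assumes c: "c \<in> charts_at S p" and d: "d \<in> charts_at S p"
    and G: "((G \<circ> chart_inv d) has_derivative chart_deriv d p G) (at (snd d p) within half_plane)"
  shows "chart_deriv c p G a = chart_deriv d p G (chart_deriv c p (snd d) a)"
proof -
  note c' = charts_atD[OF c] and d' = charts_atD[OF d]
  define A where "A = snd c ` (fst c \<inter> fst d)"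
  define T where "T = snd d \<circ> chart_inv c"
  have z: "snd c p \<in> A" using c' d' by (auto simp: A_def)
  have T_z: "T (snd c p) = snd d p"
    using c' by (simp add: T_def chart_inv_chart)
  have at: "at (snd c p) within half_plane = at (snd c p) within A"
    using at_within_half_plane[OF overlap_openin[OF c'(1) d'(1)], of "snd c p" UNIV] z
    by (simp add: A_def)
  have T_A: "T ` A \<subseteq> half_plane"
    using c' d' by (auto simp: T_def A_def chart_inv_chart chart_image_half_plane)
  have "(T has_derivative chart_deriv c p (snd d)) (at (snd c p) within A)"
    using transition_has_derivative[OF c d] by (simp add: T_def at)
  moreover have "((G \<circ> chart_inv d) has_derivative chart_deriv d p G)
      (at (T (snd c p)) within T ` A)"
    unfolding T_z using G T_A by (rule has_derivative_subset)
  ultimately have "((G \<circ> chart_inv d) \<circ> T has_derivative chart_deriv d p G \<circ> chart_deriv c p (snd d))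
      (at (snd c p) within A)"
    by (rule diff_chain_within)
  then have "((G \<circ> chart_inv c) has_derivative chart_deriv d p G \<circ> chart_deriv c p (snd d))
      (at (snd c p) within A)"
    by (rule has_derivative_transform[OF z, rotated])
      (use c' d' in \<open>auto simp: T_def A_def chart_inv_chart\<close>)
  then have "chart_deriv c p G = chart_deriv d p G \<circ> chart_deriv c p (snd d)"
    unfolding chart_deriv_def at[symmetric]
    by (rule frechet_derivative_half_plane) (rule chart_image_half_plane[OF c'])
  then show ?thesis by simp
qed

lemma chart_deriv_self:
  assumes c: "c \<in> charts_at S p"
  shows "chart_deriv c p (snd c) a = a"
proof -
  note c' = charts_atD[OF c]
  have at: "at (snd c p) within half_plane = at (snd c p) within snd c ` fst c"
    using at_within_half_plane[OF chart_image_openin[OF c'(1)], of "snd c p" UNIV] c' by simp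
  have "((snd c \<circ> chart_inv c) has_derivative (\<lambda>a. a)) (at (snd c p) within snd c ` fst c)"
    by (rule has_derivative_transform[OF _ _ has_derivative_ident])
      (use c' in \<open>auto simp: chart_inv_chart\<close>)
  then have "chart_deriv c p (snd c) = (\<lambda>a. a)"
    unfolding chart_deriv_def at[symmetric]
    by (rule frechet_derivative_half_plane) (rule chart_image_half_plane[OF c'])
  then show ?thesis by simp
qed

lemma coord_vec_tangent:
  assumes c: "c \<in> charts_at S p"
  shows "coord_vec S c p a \<in> tangent_space S p" "coord_vec S c p a c = a"
proof -
  show "coord_vec S c p a \<in> tangent_space S p"
    unfolding tangent_space_def coord_vec_def
    by (auto intro: chart_deriv_chain[OF c] transition_has_derivative)
  show "coord_vec S c p a c = a"
    using c by (simp add: coord_vec_def chart_deriv_self)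
qed

lemma tangent_spaceD:
  assumes "v \<in> tangent_space S p"
  shows tangent_outside: "c \<notin> charts_at S p \<Longrightarrow> v c = 0"
    and tangent_change_chart:
      "c \<in> charts_at S p \<Longrightarrow> d \<in> charts_at S p \<Longrightarrow> v d = chart_deriv c p (snd d) (v c)"
  using assms unfolding tangent_space_def by blast+

lemma chart_deriv_linear:
  assumes "((G \<circ> chart_inv c) has_derivative chart_deriv c p G) (at (snd c p) within half_plane)"
  shows "chart_deriv c p G (r *\<^sub>R a + b) = r *\<^sub>R chart_deriv c p G a + chart_deriv c p G b"
  using has_derivative_linear[OF assms] by (simp add: linear_add linear_scale)

lemma coord_vec_linear:
  assumes c: "c \<in> charts_at S p"
  shows "coord_vec S c p (r *\<^sub>R a + b) = (\<lambda>d. r *\<^sub>R coord_vec S c p a d + coord_vec S c p b d)"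
proof
  fix d
  show "coord_vec S c p (r *\<^sub>R a + b) d = r *\<^sub>R coord_vec S c p a d + coord_vec S c p b d"
    using chart_deriv_linear[OF transition_has_derivative[OF c], of d r a b]
    by (cases "d \<in> charts_at S p") (simp_all add: coord_vec_def)
qed

lemma tangent_space_lincomb:
  assumes "u \<in> tangent_space S p" "v \<in> tangent_space S p"
  shows "(\<lambda>d. r *\<^sub>R u d + v d) \<in> tangent_space S p"
proof -
  have "r *\<^sub>R u d + v d = chart_deriv c p (snd d) (r *\<^sub>R u c + v c)"
    if c: "c \<in> charts_at S p" and d: "d \<in> charts_at S p" for c d
  proof -
    show ?thesis
      unfolding chart_deriv_linear[OF transition_has_derivative[OF c d]]
      by (intro arg_cong2[where f = "(+)"] arg_cong[where f = "\<lambda>x. r *\<^sub>R x"]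
          tangent_change_chart assms c d)
  qed
  moreover have "r *\<^sub>R u c + v c = 0" if "c \<notin> charts_at S p" for c
    using tangent_outside[OF assms(1) that] tangent_outside[OF assms(2) that] by simp
  ultimately show ?thesis
    unfolding tangent_space_def by blast
qed

lemma X_has_derivative:
  assumes c: "c \<in> charts_at S p"
  shows "((X \<circ> chart_inv c) has_derivative chart_deriv c p X) (at (snd c p) within half_plane)"
  unfolding chart_deriv_def
  by (rule smooth_on_has_derivative[OF _ chart_image_openin])
    (use isothermal charts_atD[OF c] in \<open>auto simp: isothermal_coords_def\<close>)

text \<open>The chain rule makes the differential independent of the chart chosen by \<open>SOME\<close> in
  its definition.\<close>

lemma diff_in_chart:
  assumes v: "v \<in> tangent_space S p" and c: "c \<in> charts_at S p"
  shows "diff S X p v = chart_deriv c p X (v c)"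
proof -
  define d where "d = (SOME d. d \<in> charts_at S p)"
  have d: "d \<in> charts_at S p" unfolding d_def using c by (rule someI)
  have "chart_deriv c p X (v c) = chart_deriv d p X (chart_deriv c p (snd d) (v c))"
    by (rule chart_deriv_chain[OF c d X_has_derivative[OF d]])
  also have "chart_deriv c p (snd d) (v c) = v d"
    by (rule tangent_change_chart[OF v c d, symmetric])
  finally show ?thesis
    by (simp add: diff_def d_def Let_def)
qed

lemma diff_lincomb:
  assumes p: "p \<in> points S" and u: "u \<in> tangent_space S p" and v: "v \<in> tangent_space S p"
  shows "diff S X p (\<lambda>d. r *\<^sub>R u d + v d) = r *\<^sub>R diff S X p u + diff S X p v"
proof -
  obtain c where c: "c \<in> charts_at S p" using chart_at_exists[OF p] .
  show ?thesis
    using chart_deriv_linear[OF X_has_derivative[OF c]]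
    by (simp add: diff_in_chart[OF _ c] u v tangent_space_lincomb)
qed

text \<open>The metric is a multiple of the pullback of the Euclidean one, so it vanishes on the
  kernel of the differential.\<close>

lemma diff_eq_0_imp:
  assumes p: "p \<in> points S" and u: "u \<in> tangent_space S p" and "diff S X p u = 0"
  shows "u = (\<lambda>_. 0)"
proof (rule ccontr)
  assume "u \<noteq> (\<lambda>_. 0)"
  moreover have "\<forall>p\<in>points S. \<forall>u\<in>tangent_space S p. \<forall>v\<in>tangent_space S p.
        metric S p u v = metric S p v u \<and>
        (\<forall>w\<in>tangent_space S p. \<forall>r::real.
           metric S p (\<lambda>c. r *\<^sub>R u c + v c) w = r * metric S p u w + metric S p v w) \<and>
        (u \<noteq> (\<lambda>_. 0) \<longrightarrow> 0 < metric S p u u)"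
    using riemannian unfolding riemannian_surface_def by (elim conjE)
  ultimately have "0 < metric S p u u"
    using p u by blast
  moreover have "metric S p u u = exp (2 * lam p) * (diff S X p u \<bullet> diff S X p u)"
    using isothermal p u unfolding isothermal_coords_def by blast
  ultimately show False using assms(3) by simp
qed

text \<open>The Jacobian determinant of \<open>X\<close> in a chart, as \<open>Im (cnj a * b)\<close> is the
  determinant of the vectors \<open>a\<close>, \<open>b\<close> of the plane; \<open>coord_solve\<close> is Cramer's rule. The explicit
  formulas make the continuity of the inverse evident.\<close>

definition coord_det :: "'a chart \<Rightarrow> 'a \<Rightarrow> real" where
  "coord_det c p = Im (cnj (chart_deriv c p X 1) * chart_deriv c p X \<i>)"

definition coord_solve :: "'a chart \<Rightarrow> 'a \<Rightarrow> complex \<Rightarrow> complex" where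
  "coord_solve c p b =
     Complex (Im (cnj b * chart_deriv c p X \<i>) / coord_det c p)
             (Im (cnj (chart_deriv c p X 1) * b) / coord_det c p)"

lemma chart_deriv_X_coords:
  assumes c: "c \<in> charts_at S p"
  shows "chart_deriv c p X a
    = of_real (Re a) * chart_deriv c p X 1 + of_real (Im a) * chart_deriv c p X \<i>"
proof -
  have lin: "linear (chart_deriv c p X)"
    by (rule has_derivative_linear[OF X_has_derivative[OF c]])
  have "a = Re a *\<^sub>R 1 + Im a *\<^sub>R \<i>" by (simp add: complex_eq_iff)
  then have "chart_deriv c p X a = chart_deriv c p X (Re a *\<^sub>R 1 + Im a *\<^sub>R \<i>)" by simp
  also have "\<dots> = Re a *\<^sub>R chart_deriv c p X 1 + Im a *\<^sub>R chart_deriv c p X \<i>"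
    using lin by (simp only: linear_add linear_scale)
  finally show ?thesis by (simp add: scaleR_conv_of_real)
qed

lemma chart_deriv_X_eq_0_imp:
  assumes c: "c \<in> charts_at S p" and "chart_deriv c p X a = 0"
  shows "a = 0"
proof -
  have p: "p \<in> points S" using c by (rule charts_at_points)
  have "coord_vec S c p a = (\<lambda>_. 0)"
    using assms(2) coord_vec_tangent[OF c] by (intro diff_eq_0_imp[OF p]) (simp_all add: diff_in_chart[OF _ c])
  then show ?thesis using coord_vec_tangent(2)[OF c, of a] by simp
qed

lemma coord_det_nonzero:
  assumes c: "c \<in> charts_at S p"
  shows "coord_det c p \<noteq> 0"
proof
  assume det: "coord_det c p = 0"
  define P where "P = chart_deriv c p X 1"
  define Q where "Q = chart_deriv c p X \<i>"
  have "P \<noteq> 0" using chart_deriv_X_eq_0_imp[OF c, of 1] by (auto simp: P_def)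
  have im: "Re P * Im Q = Im P * Re Q"
    using det by (simp add: coord_det_def P_def Q_def)
  \<comment> \<open>If \<open>P\<close> and \<open>Q\<close> are parallel, then \<open>|P|\<^sup>2 Q\<close> is the inner product of \<open>P\<close> and \<open>Q\<close> times \<open>P\<close>;
      \<open>a\<close> is this relation read as a kernel vector.\<close>
  define a where "a = Complex (- Re (cnj P * Q)) (Re (cnj P * P))"
  have "chart_deriv c p X a = of_real (Re a) * P + of_real (Im a) * Q"
    unfolding P_def Q_def by (rule chart_deriv_X_coords[OF c])
  also have "\<dots> = 0"
    using im by (simp add: a_def complex_eq_iff) algebra
  finally have "a = 0" by (rule chart_deriv_X_eq_0_imp[OF c])
  then have "(Re P)\<^sup>2 + (Im P)\<^sup>2 = 0" by (simp add: a_def complex_eq_iff power2_eq_square)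
  then show False using \<open>P \<noteq> 0\<close> by (simp add: complex_eq_iff sum_power2_eq_zero_iff)
qed

lemma chart_deriv_coord_solve:
  assumes c: "c \<in> charts_at S p"
  shows "chart_deriv c p X (coord_solve c p b) = b"
proof -
  define P where "P = chart_deriv c p X 1"
  define Q where "Q = chart_deriv c p X \<i>"
  define D where "D = Im (cnj P * Q)"
  have D: "D \<noteq> 0" using coord_det_nonzero[OF c] by (simp add: coord_det_def D_def P_def Q_def)
  have cramer: "of_real (Im (cnj b * Q)) * P + of_real (Im (cnj P * b)) * Q = of_real D * b"
    by (simp add: D_def complex_eq_iff algebra_simps)
  have "chart_deriv c p X (coord_solve c p b)
      = of_real (Im (cnj b * Q) / D) * P + of_real (Im (cnj P * b) / D) * Q"
    unfolding P_def Q_def D_def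
    by (subst chart_deriv_X_coords[OF c]) (simp only: coord_solve_def coord_det_def complex.sel)
  also have "\<dots> = (of_real (Im (cnj b * Q)) * P + of_real (Im (cnj P * b)) * Q) / of_real D"
    by (simp add: add_divide_distrib)
  also have "\<dots> = b" using D unfolding cramer by simp
  finally show ?thesis .
qed

lemma diff_eq_imp_eq:
  assumes p: "p \<in> points S" and u: "u \<in> tangent_space S p" and v: "v \<in> tangent_space S p"
    and "diff S X p u = diff S X p v"
  shows "u = v"
proof -
  have "diff S X p (\<lambda>d. (-1) *\<^sub>R u d + v d) = 0"
    using diff_lincomb[OF p u v, of "-1"] assms(4) by simp
  then have "(\<lambda>d. (-1) *\<^sub>R u d + v d) = (\<lambda>_. 0)"
    using tangent_space_lincomb[OF u v] by (intro diff_eq_0_imp[OF p])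
  then show ?thesis by (simp add: fun_eq_iff)
qed

lemma frame_vec_unique:
  assumes p: "p \<in> points S" and v: "v \<in> tangent_space S p"
  shows "frame_vec S X p (diff S X p v) = v"
  unfolding frame_vec_def by (rule the_equality) (simp add: v, rule diff_eq_imp_eq[OF p _ v], simp_all)

text \<open>Existence of the vectors described by \<open>frame_vec\<close>, together with their components in a chart.\<close>

lemma frame_vec_chart:
  assumes c: "c \<in> charts_at S p"
  shows "frame_vec S X p b = coord_vec S c p (coord_solve c p b)"
proof -
  have p: "p \<in> points S" using c by (rule charts_at_points)
  show ?thesis
    using frame_vec_unique[OF p coord_vec_tangent(1)[OF c, of "coord_solve c p b"]]
    by (simp add: diff_in_chart[OF coord_vec_tangent(1)[OF c] c] coord_vec_tangent(2)[OF c]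
        chart_deriv_coord_solve[OF c])
qed

lemma frame_vec:
  assumes p: "p \<in> points S"
  shows frame_vec_tangent: "frame_vec S X p a \<in> tangent_space S p"
    and diff_frame_vec: "diff S X p (frame_vec S X p a) = a"
proof -
  obtain c where c: "c \<in> charts_at S p" using chart_at_exists[OF p] .
  show "frame_vec S X p a \<in> tangent_space S p"
    using coord_vec_tangent[OF c] frame_vec_chart[OF c] by simp
  show "diff S X p (frame_vec S X p a) = a"
    using coord_vec_tangent[OF c]
    by (simp add: frame_vec_chart[OF c] diff_in_chart[OF _ c] chart_deriv_coord_solve[OF c])
qed

lemma frame_vec_linear:
  assumes p: "p \<in> points S"
  shows "frame_vec S X p (r *\<^sub>R a + b) = (\<lambda>d. r *\<^sub>R frame_vec S X p a d + frame_vec S X p b d)"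
  using frame_vec_unique[OF p tangent_space_lincomb[OF frame_vec_tangent[OF p] frame_vec_tangent[OF p]],
      of r a b]
  by (simp add: diff_lincomb[OF p] frame_vec[OF p])

section \<open>Tensor fields in the isothermal frame\<close>

lemma continuous_on_points:
  assumes h: "\<And>c. c \<in> charts S \<Longrightarrow> continuous_on (snd c ` fst c) (h \<circ> chart_inv c)"
  shows "continuous_on (points S) h"
  unfolding continuous_on_eq_continuous_within
proof
  fix p assume p: "p \<in> points S"
  obtain c where "c \<in> charts_at S p" using chart_at_exists[OF p] .
  note c = charts_atD[OF this]
  have "continuous_on (fst c) (snd c)"
    using chart_homeomorphism[OF c(1)] by (simp add: homeomorphism_def)
  then have "continuous_on (fst c) ((h \<circ> chart_inv c) \<circ> snd c)"
    by (rule continuous_on_compose) (rule h[OF c(1)])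
  then have "continuous_on (fst c) h"
    by (rule continuous_on_eq) (simp add: chart_inv_chart c)
  then have "continuous (at p within fst c) h"
    using c(2) by (simp add: continuous_on_eq_continuous_within)
  moreover obtain T where "open T" "fst c = points S \<inter> T"
    using chart_openin_points[OF c(1)] by (auto simp: openin_open)
  then have "at p within fst c = at p within points S"
    using c(2) by (intro at_within_nhd[where S = T]) auto
  ultimately show "continuous (at p within points S) h"
    by (simp add: continuous_within)
qed

lemma
  shows continuous_on_X: "continuous_on (points S) X"
    and continuous_on_lam: "continuous_on (points S) lam"
  using isothermal unfolding isothermal_coords_def
  by (blast intro: continuous_on_points smooth_on_imp_continuous_on)+

lemma inj_on_X: "inj_on X (points S)"
  using isothermal by (simp add: isothermal_coords_def)

lemma continuous_on_chart_deriv_X: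
  assumes c: "c \<in> charts S"
  shows "continuous_on (snd c ` fst c) (\<lambda>z. chart_deriv c (chart_inv c z) X a)"
proof -
  have "smooth_on (snd c ` fst c) (X \<circ> chart_inv c)"
    using isothermal c unfolding isothermal_coords_def by blast
  then have "continuous_on (snd c ` fst c)
      (\<lambda>z. frechet_derivative (X \<circ> chart_inv c) (at z within half_plane) a)"
    by (rule smooth_on_continuous_deriv) (rule chart_image_openin[OF c])
  then show ?thesis
    by (rule continuous_on_eq) (auto simp: chart_deriv_def chart_inv_chart[OF c])
qed

lemma continuous_on_coord_solve:
  assumes c: "c \<in> charts S" and b: "continuous_on (snd c ` fst c) b"
  shows "continuous_on (snd c ` fst c) (\<lambda>z. coord_solve c (chart_inv c z) (b z))"
proof -
  have "coord_det c (chart_inv c z) \<noteq> 0" if "z \<in> snd c ` fst c" for z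
    using that by (intro coord_det_nonzero) (auto simp: charts_at_def chart_inv_chart[OF c] c)
  then have "\<forall>z\<in>snd c ` fst c. Im (cnj (chart_deriv c (chart_inv c z) X 1)
      * chart_deriv c (chart_inv c z) X \<i>) \<noteq> 0"
    unfolding coord_det_def by blast
  then show ?thesis
    unfolding coord_solve_def coord_det_def Complex_eq
    by (intro continuous_intros continuous_on_chart_deriv_X[OF c] b)
qed

lemma smooth_symmetric_tensorD:
  assumes "smooth_symmetric_tensor S m f"
  shows tensor_symmetric: "p \<in> points S \<Longrightarrow> vs \<in> tangent_lists S m p \<Longrightarrow> mset us = mset vs \<Longrightarrow>
      f p us = f p vs"
    and tensor_linear: "p \<in> points S \<Longrightarrow> vs \<in> tangent_lists S m p \<Longrightarrow> i < m \<Longrightarrow>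
      u \<in> tangent_space S p \<Longrightarrow> v \<in> tangent_space S p \<Longrightarrow>
      f p (vs[i := (\<lambda>c. r *\<^sub>R u c + v c)]) = of_real r * f p (vs[i := u]) + f p (vs[i := v])"
    and tensor_smooth: "c \<in> charts S \<Longrightarrow> length as = m \<Longrightarrow>
      smooth_on (snd c ` fst c) (\<lambda>z. f (chart_inv c z) (map (coord_vec S c (chart_inv c z)) as))"
  using assms unfolding smooth_symmetric_tensor_def by blast+

lemma multilinear_form_tensor:
  fixes L :: "complex \<Rightarrow> 'a tangent"
  assumes f: "smooth_symmetric_tensor S m f" and p: "p \<in> points S"
    and L: "\<And>a. L a \<in> tangent_space S p"
      "\<And>r a b. L (r *\<^sub>R a + b) = (\<lambda>c. r *\<^sub>R L a c + L b c)"
  shows "multilinear_form m (\<lambda>as. f p (map L as))"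
  unfolding multilinear_form_def
proof (intro allI impI)
  fix us vs :: "complex list" and a b :: complex and r :: real
  assume len: "Suc (length us + length vs) = m"
  have "map L (us @ a # vs) \<in> tangent_lists S m p"
    using len L(1) by (auto simp: tangent_lists_def)
  moreover have "length us < m" using len by simp
  ultimately have "f p ((map L (us @ a # vs))[length us := (\<lambda>c. r *\<^sub>R L a c + L b c)])
      = of_real r * f p ((map L (us @ a # vs))[length us := L a])
        + f p ((map L (us @ a # vs))[length us := L b])"
    by (intro tensor_linear[OF f p] L(1))
  then show "f p (map L (us @ (r *\<^sub>R a + b) # vs))
      = of_real r * f p (map L (us @ a # vs)) + f p (map L (us @ b # vs))"
    by (simp add: L(2) list_update_append)
qed

text \<open>The tensor in the orthonormal frame \<open>e\<^sup>-\<^sup>\<lambda> \<partial>\<^sub>1, e\<^sup>-\<^sup>\<lambda> \<partial>\<^sub>2\<close>. The factor \<open>e\<^sup>-\<^sup>\<lambda>\<close> makes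
  the complex numbers of modulus 1 correspond to the unit tangent vectors.\<close>

definition frame_form :: "'a tensor_field \<Rightarrow> 'a \<Rightarrow> complex list \<Rightarrow> complex" where
  "frame_form f p as = f p (map (\<lambda>a. frame_vec S X p (exp (- lam p) *\<^sub>R a)) as)"

lemma multilinear_frame_form:
  assumes "smooth_symmetric_tensor S m f" "p \<in> points S"
  shows "multilinear_form m (frame_form f p)"
  unfolding frame_form_def
proof (rule multilinear_form_tensor[OF assms])
  show "frame_vec S X p (exp (- lam p) *\<^sub>R a) \<in> tangent_space S p" for a
    by (rule frame_vec_tangent[OF assms(2)])
  show "frame_vec S X p (exp (- lam p) *\<^sub>R (r *\<^sub>R a + b))
      = (\<lambda>c. r *\<^sub>R frame_vec S X p (exp (- lam p) *\<^sub>R a) c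
          + frame_vec S X p (exp (- lam p) *\<^sub>R b) c)" for r a b
    unfolding frame_vec_linear[OF assms(2), symmetric] by (simp add: algebra_simps)
qed

lemma symmetric_frame_form:
  assumes "smooth_symmetric_tensor S m f" "p \<in> points S"
  shows "symmetric_form m (frame_form f p)"
  unfolding symmetric_form_def frame_form_def
proof (intro allI impI)
  fix us vs :: "complex list"
  let ?L = "\<lambda>a. frame_vec S X p (exp (- lam p) *\<^sub>R a)"
  assume vs: "length vs = m" and eq: "mset us = mset vs"
  show "f p (map ?L us) = f p (map ?L vs)"
  proof (rule tensor_symmetric[OF assms])
    show "map ?L vs \<in> tangent_lists S m p"
      using vs frame_vec_tangent[OF assms(2)] by (auto simp: tangent_lists_def)
    show "mset (map ?L us) = mset (map ?L vs)" using eq by simp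
  qed
qed

text \<open>Smoothness of \<open>f\<close> is about arguments with constant components in a chart. The vectors of the
  isothermal frame have continuous components there, by Cramer's rule.\<close>

lemma continuous_on_frame_form:
  assumes f: "smooth_symmetric_tensor S m f" and as: "length as = m"
  shows "continuous_on (points S) (\<lambda>p. frame_form f p as)"
proof (rule continuous_on_points)
  fix c assume c: "c \<in> charts S"
  let ?p = "chart_inv c"
  let ?B = "snd c ` fst c"
  let ?\<Phi> = "\<lambda>z bs. f (?p z) (map (coord_vec S c (?p z)) bs)"
  let ?sol = "\<lambda>a z. coord_solve c (?p z) (exp (- lam (?p z)) *\<^sub>R a)"
  have at: "c \<in> charts_at S (?p z)" if "z \<in> ?B" for z
    using that c by (auto simp: charts_at_def chart_inv_chart)
  have "smooth_on ?B (lam \<circ> ?p)"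
    using isothermal c unfolding isothermal_coords_def by blast
  then have lam: "continuous_on ?B (\<lambda>z. lam (?p z))"
    using smooth_on_imp_continuous_on by (simp add: comp_def)
  have "continuous_on ?B (\<lambda>z. ?\<Phi> z (map (\<lambda>a. a z) (map ?sol as)))"
  proof (rule continuous_on_multilinear_form)
    show "multilinear_form (length (map ?sol as)) (?\<Phi> z)" if "z \<in> ?B" for z
      unfolding length_map as
      by (intro multilinear_form_tensor[OF f] charts_at_points[OF at]
          coord_vec_tangent(1)[OF at] coord_vec_linear[OF at] that)
    show "continuous_on ?B (\<lambda>z. ?\<Phi> z bs)" if "length bs = length (map ?sol as)" for bs
      using tensor_smooth[OF f c] that as by (auto intro: smooth_on_imp_continuous_on)
    show "continuous_on ?B a" if "a \<in> set (map ?sol as)" for a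
      using that by (auto intro!: continuous_on_coord_solve[OF c] continuous_intros lam)
  qed
  moreover have "?\<Phi> z (map (\<lambda>a. a z) (map ?sol as)) = frame_form f (?p z) as" if "z \<in> ?B" for z
    by (simp add: frame_form_def frame_vec_chart[OF at[OF that]] comp_def)
  ultimately show "continuous_on ?B ((\<lambda>p. frame_form f p as) \<circ> ?p)"
    by (simp add: comp_def cong: continuous_on_cong)
qed

lemma transverse_unit_vec:
  assumes p: "p \<in> points S"
  shows "transverse S X m k f (p, unit_vec S X lam p \<theta>)
    = frame_form f p (replicate (m - k) (cis \<theta>) @ replicate k (\<i> * cis \<theta>))"
  by (simp add: transverse_def frame_form_def unit_vec_def perp_def diff_frame_vec[OF p]
      map_replicate_const)

lemma fibre_mode_unit_vec:
  assumes p: "p \<in> points S"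
  shows "fibre_mode S X k h (p, unit_vec S X lam p \<theta>) = h p * cis (of_int k * \<theta>)"
proof -
  let ?u = "exp (- lam p) *\<^sub>R cis \<theta>"
  have "cis (Arg ?u) = sgn ?u" by (rule cis_Arg) simp
  also have "\<dots> = cis \<theta>" by (simp add: sgn_div_norm)
  finally have "cis (of_int k * Arg ?u) = cis (of_int k * \<theta>)"
    by (simp only: cis_power_int[symmetric])
  then show ?thesis
    by (simp add: fibre_mode_def angle_def unit_vec_def diff_frame_vec[OF p])
qed

lemma inj_on_unit_vec:
  assumes p: "p \<in> points S" and eq: "unit_vec S X lam p \<theta> = unit_vec S X lam p \<theta>'"
    and "\<theta> \<in> {0..<2 * pi}" "\<theta>' \<in> {0..<2 * pi}"
  shows "\<theta> = \<theta>'"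
proof -
  have "exp (- lam p) *\<^sub>R cis \<theta> = exp (- lam p) *\<^sub>R cis \<theta>'"
    using arg_cong[OF eq, of "diff S X p"] by (simp only: unit_vec_def diff_frame_vec[OF p])
  then have "cis \<theta> = cis \<theta>'" by simp
  then obtain n :: int where n: "\<theta> = \<theta>' + 2 * pi * of_int n"
    using sin_cos_eq_iff[of \<theta> \<theta>'] by (auto simp: complex_eq_iff)
  then have "\<bar>2 * pi * of_int n\<bar> < 2 * pi * 1"
    using assms(3,4) by auto
  then have "\<bar>real_of_int n\<bar> < 1"
    by (simp add: abs_mult)
  then show ?thesis using n by simp
qed

lemma frame_form_frame_coords:
  assumes p: "p \<in> points S" and vs: "set vs \<subseteq> tangent_space S p"
  shows "f p vs = frame_form f p (map (\<lambda>v. exp (lam p) *\<^sub>R diff S X p v) vs)"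
proof -
  have "map ((\<lambda>a. frame_vec S X p (exp (- lam p) *\<^sub>R a)) \<circ> (\<lambda>v. exp (lam p) *\<^sub>R diff S X p v)) vs = vs"
    using vs by (intro map_idI) (auto simp: frame_vec_unique[OF p] exp_minus)
  then show ?thesis by (simp add: frame_form_def)
qed

section \<open>Square integrability and null sets\<close>

lemma compact_X_image: "compact (X ` points S)"
  by (rule compact_continuous_image[OF continuous_on_X compact_points])

lemma continuous_on_inv_X: "continuous_on (X ` points S) (inv_into (points S) X)"
  by (rule continuous_on_inv[OF continuous_on_X compact_points]) (simp add: inj_on_X)

lemma inv_X_points: "z \<in> X ` points S \<Longrightarrow> inv_into (points S) X z \<in> points S"
  by (rule inv_into_into)

lemma continuous_on_comp_inv_X:
  assumes "continuous_on (points S) h"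
  shows "continuous_on (X ` points S) (\<lambda>z. h (inv_into (points S) X z))"
  by (rule continuous_on_compose2[OF assms continuous_on_inv_X]) (auto intro: inv_X_points)

text \<open>The measures \<open>volume\<close> and \<open>liouville\<close> are both of the form treated here. Because
  the interval of angles is half-open, the domain \<open>K\<close> is embedded in a compact set \<open>C\<close>, on which
  continuity gives boundedness.\<close>

lemma L2_embed_density:
  fixes emb :: "'e::euclidean_space \<Rightarrow> 'b"
  assumes K: "K \<in> sets borel" "K \<subseteq> C" and C: "compact C" and inj: "inj_on emb K"
    and \<rho>: "continuous_on C \<rho>" "\<And>z. z \<in> C \<Longrightarrow> 0 \<le> \<rho> z"
    and F: "continuous_on C (\<lambda>z. F (emb z))"
  shows "F \<in> L2 (embed_measure (density (lebesgue_on K) (\<lambda>z. ennreal (\<rho> z))) emb)"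
proof -
  let ?M = "density (lebesgue_on K) (\<lambda>z. ennreal (\<rho> z))"
  let ?E = "embed_measure ?M emb"
  have Kl: "K \<in> sets lebesgue" using K(1) by simp
  have Kf: "K \<in> lmeasurable"
    using bounded_subset[OF compact_imp_bounded[OF C] K(2)] Kl by (rule bounded_set_imp_lmeasurable)
  have m: "g \<in> borel_measurable (lebesgue_on K)" if "continuous_on C g" for g :: "'e \<Rightarrow> 'f::real_normed_vector"
    by (rule continuous_imp_measurable_on_sets_lebesgue[OF continuous_on_subset[OF that K(2)] Kl])
  have "(\<lambda>z. F (emb z)) \<in> borel_measurable ?M"
    using m[OF F] by simp
  then have FE: "F \<in> borel_measurable ?E"
    by (rule measurable_embed_measure1)
  have c: "continuous_on C (\<lambda>z. \<rho> z *\<^sub>R (cmod (F (emb z)))\<^sup>2)"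
    by (intro continuous_intros \<rho> F)
  then obtain B where B: "\<And>z. z \<in> C \<Longrightarrow> norm (\<rho> z *\<^sub>R (cmod (F (emb z)))\<^sup>2) \<le> B"
    using compact_imp_bounded[OF compact_continuous_image[OF c C]] by (auto simp: bounded_iff)
  have "integrable (lebesgue_on K) (\<lambda>z. \<rho> z *\<^sub>R (cmod (F (emb z)))\<^sup>2)"
  proof (rule finite_measure.integrable_const_bound[OF finite_measure_lebesgue_on[OF Kf]])
    show "AE z in lebesgue_on K. norm (\<rho> z *\<^sub>R (cmod (F (emb z)))\<^sup>2) \<le> B"
      using B K(2) by (intro AE_I2) auto
  qed (rule m[OF c])
  then have "integrable ?M (\<lambda>z. (cmod (F (emb z)))\<^sup>2)"
    using m[OF F] m[OF \<rho>(1)] \<rho>(2) K(2)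
    by (subst integrable_density) (auto intro!: AE_I2)
  then have "integrable (distr ?M ?E emb) (\<lambda>x. (cmod (F x))\<^sup>2)"
    using FE inj measurable_embed_measure2'[of emb ?M] by (subst integrable_distr_eq) auto
  then have "integrable ?E (\<lambda>x. (cmod (F x))\<^sup>2)"
    using embed_measure_eq_distr'[of emb ?M] inj by simp
  then show ?thesis using FE by (simp add: L2_def)
qed

lemma L2_volume:
  assumes h: "continuous_on (points S) h"
  shows "h \<in> L2 (volume S X lam)"
  unfolding volume_def Let_def
proof (rule L2_embed_density[OF _ order_refl compact_X_image])
  show "X ` points S \<in> sets borel"
    using compact_X_image by (intro borel_closed compact_imp_closed)
  show "continuous_on (X ` points S) (\<lambda>z. exp (2 * lam (inv_into (points S) X z)))"
    by (intro continuous_intros continuous_on_comp_inv_X continuous_on_lam)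
  show "continuous_on (X ` points S) (\<lambda>z. h (inv_into (points S) X z))"
    by (intro continuous_on_comp_inv_X h)
qed (auto intro: inj_on_inv_into)

lemma L2_liouville:
  assumes "continuous_on (X ` points S \<times> {0..2 * pi})
    (\<lambda>(z, \<theta>). F (inv_into (points S) X z, unit_vec S X lam (inv_into (points S) X z) \<theta>))"
  shows "F \<in> L2 (liouville S X lam)"
proof -
  let ?Y = "inv_into (points S) X"
  let ?emb = "\<lambda>(z, \<theta>). (?Y z, unit_vec S X lam (?Y z) \<theta>)"
  let ?\<rho> = "\<lambda>y::complex \<times> real. exp (2 * lam (?Y (fst y)))"
  have "F \<in> L2 (embed_measure (density (lebesgue_on (X ` points S \<times> {0..<2 * pi}))
      (\<lambda>y. ennreal (?\<rho> y))) ?emb)"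
  proof (rule L2_embed_density)
    show "X ` points S \<times> {0..<2 * pi} \<in> sets borel"
      unfolding borel_prod[symmetric]
      using borel_closed[OF compact_imp_closed[OF compact_X_image]] by (intro pair_measureI) auto
    show "X ` points S \<times> {0..<2 * pi} \<subseteq> X ` points S \<times> {0..2 * pi}" by auto
    show "compact (X ` points S \<times> {0..2 * pi})"
      by (intro compact_Times compact_X_image compact_Icc)
    show "inj_on ?emb (X ` points S \<times> {0..<2 * pi})"
    proof (rule inj_onI, clarify)
      fix p \<theta> q \<theta>'
      assume pq: "p \<in> points S" "q \<in> points S" "\<theta> \<in> {0..<2 * pi}" "\<theta>' \<in> {0..<2 * pi}"
        and Y: "?Y (X p) = ?Y (X q)"
        and u: "unit_vec S X lam (?Y (X p)) \<theta> = unit_vec S X lam (?Y (X q)) \<theta>'"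
      have "p = q" using Y pq by (simp add: inj_on_X)
      moreover have "\<theta> = \<theta>'"
        using u pq \<open>p = q\<close> by (intro inj_on_unit_vec[of p]) (simp_all add: inj_on_X)
      ultimately show "X p = X q \<and> \<theta> = \<theta>'" by simp
    qed
    show "continuous_on (X ` points S \<times> {0..2 * pi}) ?\<rho>"
      by (intro continuous_intros continuous_on_compose2[OF continuous_on_comp_inv_X[OF continuous_on_lam]])
        auto
    show "continuous_on (X ` points S \<times> {0..2 * pi}) (\<lambda>y. F (?emb y))"
      using assms by (simp add: case_prod_unfold)
  qed simp
  then show ?thesis
    unfolding liouville_def Let_def by (simp add: case_prod_unfold)
qed

lemma space_liouville:
  "space (liouville S X lam) = (\<lambda>(p, \<theta>). (p, unit_vec S X lam p \<theta>)) ` (points S \<times> {0..<2 * pi})"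
  by (force simp: liouville_def Let_def space_embed_measure inj_on_X inv_X_points image_iff)

lemma L2_transverse:
  assumes f: "smooth_symmetric_tensor S m f" and k: "k \<le> m"
  shows "transverse S X m k f \<in> L2 (liouville S X lam)"
proof (rule L2_liouville)
  let ?Y = "inv_into (points S) X"
  let ?A = "X ` points S \<times> {0..2 * pi}"
  define as :: "(complex \<times> real \<Rightarrow> complex) list" where
    "as = replicate (m - k) (\<lambda>y. cis (snd y)) @ replicate k (\<lambda>y. \<i> * cis (snd y))"
  have len: "length as = m" using k by (simp add: as_def)
  have "continuous_on ?A (\<lambda>y. frame_form f (?Y (fst y)) (map (\<lambda>a. a y) as))"
  proof (rule continuous_on_multilinear_form)
    show "multilinear_form (length as) (frame_form f (?Y (fst y)))" if "y \<in> ?A" for y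
      unfolding len using that by (intro multilinear_frame_form[OF f] inv_X_points) auto
    show "continuous_on ?A (\<lambda>y. frame_form f (?Y (fst y)) bs)" if "length bs = length as" for bs
      using that len
      by (intro continuous_on_compose2[OF continuous_on_comp_inv_X[OF continuous_on_frame_form[OF f]]]
          continuous_intros) auto
    show "continuous_on ?A a" if "a \<in> set as" for a
      using that unfolding as_def by (auto intro!: continuous_intros split: if_splits)
  qed
  then show "continuous_on ?A (\<lambda>(z, \<theta>). transverse S X m k f (?Y z, unit_vec S X lam (?Y z) \<theta>))"
    by (rule continuous_on_eq) (auto simp: transverse_unit_vec inj_on_X as_def)
qed

lemma L2_fibre_mode:
  assumes h: "continuous_on (points S) h"
  shows "fibre_mode S X k h \<in> L2 (liouville S X lam)"
proof (rule L2_liouville)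
  let ?Y = "inv_into (points S) X"
  let ?A = "X ` points S \<times> {0..2 * pi}"
  have "continuous_on ?A (\<lambda>y. h (?Y (fst y)) * cis (of_int k * snd y))"
    by (intro continuous_intros continuous_on_compose2[OF continuous_on_comp_inv_X[OF h]]) auto
  then show "continuous_on ?A (\<lambda>(z, \<theta>). fibre_mode S X k h (?Y z, unit_vec S X lam (?Y z) \<theta>))"
    by (rule continuous_on_eq) (auto simp: fibre_mode_unit_vec inj_on_X)
qed

text \<open>A null set contains no nonempty relatively open subset of the surface, for any such subset
  contains a piece on which a chart is a homeomorphism onto an open set of the plane: near a boundary
  point one moves slightly into the interior of the half plane. The isothermal coordinate is
  continuous and injective on that piece, so by invariance of domain its image is open in the plane
  and has positive measure.\<close>

lemma AE_volume_imp_eq: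
  fixes h h' :: "'a \<Rightarrow> complex"
  assumes h: "continuous_on (points S) h" and h': "continuous_on (points S) h'"
    and ae: "AE x in volume S X lam. h x = h' x" and p: "p \<in> points S"
  shows "h p = h' p"
proof (rule ccontr)
  assume ne: "h p \<noteq> h' p"
  let ?Y = "inv_into (points S) X"
  let ?K = "X ` points S"
  let ?\<rho> = "\<lambda>z. exp (2 * lam (?Y z))"
  have Kl: "?K \<in> sets lebesgue"
    using borel_closed[OF compact_imp_closed[OF compact_X_image]] by simp
  have "continuous_on ?K ?\<rho>"
    by (intro continuous_intros continuous_on_comp_inv_X continuous_on_lam)
  then have \<rho>: "(\<lambda>z. ennreal (?\<rho> z)) \<in> borel_measurable (lebesgue_on ?K)"
    using continuous_imp_measurable_on_sets_lebesgue Kl by (intro measurable_compose[OF _ measurable_ennreal]) blast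
  have "AE z in density (lebesgue_on ?K) (\<lambda>z. ennreal (?\<rho> z)). h (?Y z) = h' (?Y z)"
    using ae unfolding volume_def Let_def
    by (subst (asm) AE_embed_measure') (auto intro: inj_on_inv_into)
  then have "AE z in lebesgue_on ?K. h (?Y z) = h' (?Y z)"
    unfolding AE_density[OF \<rho>] by simp
  then have "AE z in lebesgue. z \<in> ?K \<longrightarrow> h (?Y z) = h' (?Y z)"
    using Kl by (subst (asm) AE_restrict_space_iff) auto
  then obtain N where N: "N \<in> null_sets lebesgue" "{z. \<not> (z \<in> ?K \<longrightarrow> h (?Y z) = h' (?Y z))} \<subseteq> N"
    unfolding eventually_ae_filter by auto
  define U where "U = points S \<inter> (\<lambda>x. h x - h' x) -` (- {0})"
  have U: "openin (top_of_set (points S)) U"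
    unfolding U_def by (intro continuous_openin_preimage_gen continuous_intros h h')
  obtain c where "c \<in> charts_at S p" using chart_at_exists[OF p] .
  note c = charts_atD[OF this]
  have "openin (top_of_set half_plane) (snd c ` (U \<inter> fst c))"
    using c U chart_openin_points by (intro chart_image_openin_sub openin_Int) auto
  then obtain T where T: "open T" "snd c ` (U \<inter> fst c) = half_plane \<inter> T"
    by (auto simp: openin_open)
  define W where "W = T \<inter> {z. 0 < Im z}"
  have W: "open W" unfolding W_def by (intro open_Int T(1) open_halfspace_Im_gt)
  have sub: "W \<subseteq> snd c ` (U \<inter> fst c)"
    unfolding T(2) W_def half_plane_def by auto
  have "snd c p \<in> half_plane \<inter> T"
    unfolding T(2)[symmetric] using c p ne by (auto simp: U_def)
  then obtain e where e: "e > 0" "ball (snd c p) e \<subseteq> T" and Im: "0 \<le> Im (snd c p)"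
    using T(1) by (auto simp: open_contains_ball half_plane_def)
  have "snd c p + of_real (e / 2) * \<i> \<in> W"
    using e Im by (auto simp: W_def dist_norm norm_mult intro!: subsetD[OF e(2)])
  then have W_ne: "W \<noteq> {}" by blast
  let ?G = "X \<circ> chart_inv c"
  have "continuous_on (snd c ` fst c) ?G"
    using isothermal c(1) unfolding isothermal_coords_def by (blast intro: smooth_on_imp_continuous_on)
  then have cont: "continuous_on W ?G"
    by (rule continuous_on_subset) (use sub in auto)
  have inj: "inj_on ?G W"
  proof (rule inj_onI)
    fix a b assume "a \<in> W" "b \<in> W" and eq: "?G a = ?G b"
    then obtain x y where xy: "x \<in> fst c" "y \<in> fst c" "a = snd c x" "b = snd c y"
      using sub by blast
    then have "X x = X y" using eq c(1) by (simp add: chart_inv_chart)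
    then have "x = y" using inj_on_X xy chart_subset_points[OF c(1)] by (auto dest: inj_onD)
    then show "a = b" using xy by simp
  qed
  have "?G ` W \<subseteq> N"
  proof
    fix z assume "z \<in> ?G ` W"
    then obtain x where x: "x \<in> U" "x \<in> fst c" "z = X x"
      using sub c(1) by (auto simp: chart_inv_chart)
    then have "x \<in> points S" "h x \<noteq> h' x" by (auto simp: U_def)
    then show "z \<in> N" using N(2) x(3) by (auto simp: inj_on_X)
  qed
  then have "negligible (?G ` W)"
    using N(1) negligible_iff_null_sets negligible_subset by blast
  moreover have "open (?G ` W)"
    by (rule invariance_of_domain[OF cont W inj])
  ultimately show False using W_ne open_not_negligible by blast
qed

section \<open>Transverse ray transforms\<close>

lemma weightD:
  assumes "weight S X lam w" "F \<in> L2 (liouville S X lam)"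
  shows weight_integrable: "AE q in influx_measure S X lam.
      set_integrable lebesgue {0..exit_time S q} (\<lambda>t. w (flow S t q) * F (flow S t q))"
    and weight_cong: "F' \<in> L2 (liouville S X lam) \<Longrightarrow> AE q in liouville S X lam. F q = F' q \<Longrightarrow>
      AE q in influx_measure S X lam. ray_transform S w F q = ray_transform S w F' q"
  using assms unfolding weight_def by blast+

text \<open>The linear relation between the integrands is only supposed on the space of the Liouville measure.
  A function \<open>F'\<close> that satisfies it everywhere differs from \<open>F\<close> only off that space, and the
  weight does not distinguish the two. Then linearity of the integral applies along almost every
  geodesic, namely where all the integrals exist.\<close>

lemma ray_transform_sum:
  assumes w: "weight S X lam w" and J: "finite J"
    and G: "\<And>j. j \<in> J \<Longrightarrow> G j \<in> L2 (liouville S X lam)"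
    and F: "F \<in> L2 (liouville S X lam)"
    and eq: "\<And>q. q \<in> space (liouville S X lam) \<Longrightarrow> F q = (\<Sum>j\<in>J. e j * G j q)"
  shows "AE q in influx_measure S X lam.
    ray_transform S w F q = (\<Sum>j\<in>J. e j * ray_transform S w (G j) q)"
proof -
  define F' where "F' q = (\<Sum>j\<in>J. e j * G j q)" for q
  have FF': "F q = F' q" if "q \<in> space (liouville S X lam)" for q
    using eq[OF that] by (simp add: F'_def)
  have "F' \<in> borel_measurable (liouville S X lam)"
    using F FF' by (subst measurable_cong[where g = F]) (simp_all add: L2_def)
  moreover have "integrable (liouville S X lam) (\<lambda>q. (cmod (F' q))\<^sup>2)"
    using F FF' Bochner_Integration.integrable_cong[OF refl, of "liouville S X lam"
      "\<lambda>q. (cmod (F q))\<^sup>2" "\<lambda>q. (cmod (F' q))\<^sup>2"] by (simp add: L2_def)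
  ultimately have F': "F' \<in> L2 (liouville S X lam)"
    by (simp add: L2_def)
  have "AE q in influx_measure S X lam. ray_transform S w F q = ray_transform S w F' q"
    by (rule weight_cong[OF w F F']) (use FF' in \<open>auto intro: AE_I2\<close>)
  moreover have "AE q in influx_measure S X lam. \<forall>j\<in>J.
      set_integrable lebesgue {0..exit_time S q} (\<lambda>t. w (flow S t q) * G j (flow S t q))"
    using weight_integrable[OF w G] by (rule AE_finite_allI[OF J])
  ultimately show ?thesis
  proof eventually_elim
    case (elim q)
    let ?A = "{0..exit_time S q}"
    have "ray_transform S w F' q
        = (LINT t:?A|lebesgue. (\<Sum>j\<in>J. e j * (w (flow S t q) * G j (flow S t q))))"
      by (simp add: ray_transform_def F'_def sum_distrib_left mult.left_commute)
    also have "\<dots> = (\<Sum>j\<in>J. LINT t:?A|lebesgue. e j * (w (flow S t q) * G j (flow S t q)))"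
      using elim(2) unfolding set_lebesgue_integral_def set_integrable_def scaleR_sum_right
      by (subst Bochner_Integration.integral_sum)
        (auto simp: mult_scaleR_right[symmetric] simp del: mult_scaleR_right)
    also have "\<dots> = (\<Sum>j\<in>J. e j * ray_transform S w (G j) q)"
      by (simp add: ray_transform_def)
    finally show ?case using elim(1) by simp
  qed
qed

text \<open>The two descriptions of the contraction for \<open>z = e\<^sup>\<i>\<^sup>\<theta>\<close>: by rotation it is a single
  Fourier mode in \<open>\<theta>\<close>, by expansion a combination of the transverse functions.\<close>

lemma fibre_mode_null_contraction:
  assumes f: "smooth_symmetric_tensor S m f" and ss: "length ss = m" "set ss \<subseteq> {1, -1}"
    and e: "\<And>z \<Phi>. symmetric_form m \<Phi> \<Longrightarrow> null_contraction z ss \<Phi>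
      = (\<Sum>k\<le>m. e k * \<Phi> (replicate (m - k) z @ replicate k (\<i> * z)))"
    and q: "q \<in> space (liouville S X lam)"
  shows "fibre_mode S X (- sum_list ss) (\<lambda>p. null_contraction 1 ss (frame_form f p)) q
    = (\<Sum>k\<le>m. e k * transverse S X m k f q)"
proof -
  obtain p \<theta> where p: "p \<in> points S" and q': "q = (p, unit_vec S X lam p \<theta>)"
    using q unfolding space_liouville by auto
  have "fibre_mode S X (- sum_list ss) (\<lambda>p. null_contraction 1 ss (frame_form f p)) q
      = null_contraction (cis \<theta>) ss (frame_form f p)"
    using null_contraction_rotate[OF ss(2), of "frame_form f p" \<theta>] multilinear_frame_form[OF f p] ss(1)
    unfolding q' fibre_mode_unit_vec[OF p] by (simp add: mult.commute)
  also have "\<dots> = (\<Sum>k\<le>m. e k * transverse S X m k f q)"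
    using e[OF symmetric_frame_form[OF f p], of "cis \<theta>"]
    by (simp add: q' transverse_unit_vec[OF p])
  finally show ?thesis .
qed

lemma null_contraction_determined:
  assumes w: "weight S X lam w"
    and inj: "\<And>k::int. even (int m - k) \<Longrightarrow> \<bar>k\<bar> \<le> int m \<Longrightarrow> scalar_transform_injective S X lam w k"
    and f: "smooth_symmetric_tensor S m f" and f': "smooth_symmetric_tensor S m f'"
    and eq: "\<And>k. k \<le> m \<Longrightarrow> AE q in influx_measure S X lam.
      ray_transform S w (transverse S X m k f) q = ray_transform S w (transverse S X m k f') q"
    and ss: "length ss = m" "set ss \<subseteq> {1, -1}" and p: "p \<in> points S"
  shows "null_contraction 1 ss (frame_form f p) = null_contraction 1 ss (frame_form f' p)"
proof -
  define H where "H f p = null_contraction 1 ss (frame_form f p)" for f :: "'a tensor_field" and p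
  let ?k = "- sum_list ss"
  obtain e where e: "\<And>z \<Phi>. symmetric_form m \<Phi> \<Longrightarrow> null_contraction z ss \<Phi>
      = (\<Sum>k\<le>m. e k * \<Phi> (replicate (m - k) z @ replicate k (\<i> * z)))"
    using null_contraction_expand[of ss] unfolding ss(1) by blast
  have cont: "continuous_on (points S) (H g)" if g: "smooth_symmetric_tensor S m g" for g
  proof -
    have "continuous_on (points S)
        (\<lambda>p. \<Sum>k\<le>m. e k * frame_form g p (replicate (m - k) 1 @ replicate k (\<i> * 1)))"
      by (intro continuous_intros continuous_on_frame_form[OF g]) simp
    then show ?thesis
      by (rule continuous_on_eq) (simp only: H_def e[OF symmetric_frame_form[OF g]])
  qed
  have expand: "AE q in influx_measure S X lam. ray_transform S w (fibre_mode S X ?k (H g)) q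
      = (\<Sum>k\<le>m. e k * ray_transform S w (transverse S X m k g) q)"
    if g: "smooth_symmetric_tensor S m g" for g
  proof (rule ray_transform_sum[OF w])
    show "fibre_mode S X ?k (H g) q = (\<Sum>k\<le>m. e k * transverse S X m k g q)"
      if "q \<in> space (liouville S X lam)" for q
      unfolding H_def by (rule fibre_mode_null_contraction[OF g ss e that])
  qed (use L2_transverse[OF g] L2_fibre_mode[OF cont[OF g]] in auto)
  have "AE q in influx_measure S X lam. \<forall>k\<in>{..m}.
      ray_transform S w (transverse S X m k f) q = ray_transform S w (transverse S X m k f') q"
    using eq by (intro AE_finite_allI) auto
  with expand[OF f] expand[OF f']
  have "AE q in influx_measure S X lam. ray_transform S w (fibre_mode S X ?k (H f)) q
      = ray_transform S w (fibre_mode S X ?k (H f')) q"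
    by eventually_elim simp
  moreover have "\<bar>?k\<bar> \<le> int m \<and> even (int m - ?k)"
    using ss(2) unfolding ss(1)[symmetric] by (induction ss) auto
  then have "scalar_transform_injective S X lam w ?k"
    using inj by blast
  ultimately have "AE x in volume S X lam. H f x = H f' x"
    using L2_volume[OF cont[OF f]] L2_volume[OF cont[OF f']]
    unfolding scalar_transform_injective_def by blast
  then show ?thesis
    using AE_volume_imp_eq[OF cont[OF f] cont[OF f'] _ p] by (simp add: H_def)
qed

end

theorem theorem4:
  fixes S :: "('a::t2_space) surface"
    and X :: "'a \<Rightarrow> complex"
    and lam :: "'a \<Rightarrow> real"
    and w :: "'a \<times> 'a tangent \<Rightarrow> complex"
    and m :: nat
    and f f' :: "'a tensor_field"
  assumes "riemannian_surface S"
    and "isothermal_coords S X lam"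
    and "nontrapping S"
    and "strictly_convex_boundary S"
    and "weight S X lam w"
    and "\<And>k::int. even (int m - k) \<Longrightarrow> \<bar>k\<bar> \<le> int m \<Longrightarrow> scalar_transform_injective S X lam w k"
    and "smooth_symmetric_tensor S m f"
    and "smooth_symmetric_tensor S m f'"
    and "\<And>k. k \<le> m \<Longrightarrow>
           AE q in influx_measure S X lam.
             ray_transform S w (transverse S X m k f) q = ray_transform S w (transverse S X m k f') q"
  shows "\<forall>x\<in>points S. \<forall>vs\<in>tangent_lists S m x. f x vs = f' x vs"
proof (intro ballI)
  interpret isothermal_surface S X lam
    by unfold_locales fact+
  fix x vs
  assume x: "x \<in> points S" and "vs \<in> tangent_lists S m x"
  then have vs: "length vs = m" "set vs \<subseteq> tangent_space S x"
    by (auto simp: tangent_lists_def)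
  have "frame_form f x as = frame_form f' x as" if "length as = m" for as
    by (rule multilinear_form_eqI[OF multilinear_frame_form multilinear_frame_form
          null_contraction_determined[OF assms(5-9)] that]) (use assms(7,8) x in auto)
  then show "f x vs = f' x vs"
    using frame_form_frame_coords[OF x vs(2)] vs(1) by (metis length_map)
qed

end
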